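(* Let $n\ge5$. The ideal $J_{G_n}$ satisfies $\operatorname{ht}(J_{G_n})=2n-1$ and $\operatorname{bight}(J_{G_n})=4n-8$.
   Context: Graph $G_n$: let $X=\{u_0,\dots,u_{n-1}\}$ and $Y=\{v_0,\dots,v_{n-1}\}$ be disjoint, indices modulo $n$. $G_n$ is the bipartite graph on $X\sqcup Y$ with $\{u_i,v_j\}\in E(G_n)$ iff $j\notin\{i,i-1\}$ modulo $n$ (the bipartite complement of the cycle $C_{2n}$ with edges $\{u_i,v_i\},\{u_i,v_{i-1}\}$). Binomial edge ideal: let $\mathbb K$ be an arbitrary field. For a finite simple graph $G$, $S_G=\mathbb K[x_w,y_w:w\in V(G)]$ and $J_G\subseteq S_G$ is the ideal generated by $x_ay_b-x_by_a$ for all edges $\{a,b\}\in E(G)$. For an ideal $I$, $\operatorname{ht}(I)$ is the minimum and $\operatorname{bight}(I)$ (big height) the maximum of the heights of the minimal primes of $I$. *)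

theory Defs
  imports
    "HOL-Algebra.Ideal"
    "HOL-Library.Poly_Mapping"
    "HOL-Library.Extended_Nat"
    "HOL-Number_Theory.Cong"
begin

section \<open>Heights of ideals\<close>

definition minimal_primes :: "('a, 'b) ring_scheme \<Rightarrow> 'a set \<Rightarrow> 'a set set" where
  "minimal_primes R I =
     {P. primeideal P R \<and> I \<subseteq> P \<and>
         (\<forall>Q. primeideal Q R \<longrightarrow> I \<subseteq> Q \<longrightarrow> Q \<subseteq> P \<longrightarrow> Q = P)}"

text \<open>The supremum of the lengths \<open>k\<close> of chains of primes \<open>C 0 \<subset> \<dots> \<subset> C k = P\<close>.\<close>

definition prime_height :: "('a, 'b) ring_scheme \<Rightarrow> 'a set \<Rightarrow> enat" where
  "prime_height R P =
     Sup {enat k | k. \<exists>C. (\<forall>i\<le>k. primeideal (C i) R) \<and> (\<forall>i<k. C i \<subset> C (Suc i)) \<and> C k = P}"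

text \<open>
  Minimum and maximum are taken in \<^typ>\<open>enat\<close>; without minimal primes they are \<open>\<infinity>\<close> and \<open>0\<close>.  Whenever
  \<open>ht\<close> is finite, or \<open>bight\<close> is finite and nonzero, it is attained; see \<open>ht_attained\<close> and
  \<open>bight_attained\<close> below.
\<close>

definition ht :: "('a, 'b) ring_scheme \<Rightarrow> 'a set \<Rightarrow> enat" where
  "ht R I = (INF P \<in> minimal_primes R I. prime_height R P)"

definition bight :: "('a, 'b) ring_scheme \<Rightarrow> 'a set \<Rightarrow> enat" where
  "bight R I = (SUP P \<in> minimal_primes R I. prime_height R P)"


section \<open>Binomial edge ideals\<close>

datatype 'v indet = XVar 'v | YVar 'v

text \<open>Finitely supported exponent vectors, and finitely supported coefficient families on them;
  multiplication on \<^type>\<open>poly_mapping\<close> is convolution.\<close>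

type_synonym ('v, 'k) edge_poly = "('v indet \<Rightarrow>\<^sub>0 nat) \<Rightarrow>\<^sub>0 'k"

definition indet_poly :: "'v indet \<Rightarrow> ('v, 'k::field) edge_poly" where
  "indet_poly z = Poly_Mapping.single (Poly_Mapping.single z 1) 1"

abbreviation x_var :: "'v \<Rightarrow> ('v, 'k::field) edge_poly" where
  "x_var w \<equiv> indet_poly (XVar w)"

abbreviation y_var :: "'v \<Rightarrow> ('v, 'k::field) edge_poly" where
  "y_var w \<equiv> indet_poly (YVar w)"

definition indets :: "('v, 'k::field) edge_poly \<Rightarrow> 'v indet set" where
  "indets p = (\<Union>m \<in> Poly_Mapping.keys p. Poly_Mapping.keys m)"

text \<open>The polynomial ring in the variables \<open>x_w\<close>, \<open>y_w\<close> for \<open>w \<in> W\<close> only.  The field of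
  coefficients is the type \<open>'k\<close>.\<close>

definition poly_ring :: "'v set \<Rightarrow> ('v, 'k::field) edge_poly ring" where
  "poly_ring W =
     \<lparr>carrier = {p. indets p \<subseteq> XVar ` W \<union> YVar ` W},
      monoid.mult = (*), one = 1, zero = 0, add = (+)\<rparr>"

text \<open>A graph is a pair of a vertex set and a set of two-element edges.\<close>

definition finite_simple_graph :: "'v set \<times> 'v set set \<Rightarrow> bool" where
  "finite_simple_graph G \<longleftrightarrow> finite (fst G) \<and> (\<forall>e \<in> snd G. e \<subseteq> fst G \<and> card e = 2)"

abbreviation graph_ring :: "'v set \<times> 'v set set \<Rightarrow> ('v, 'k::field) edge_poly ring" where
  "graph_ring G \<equiv> poly_ring (fst G)"

text \<open>Both orientations of an edge contribute a generator; they differ by a sign.\<close>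

definition binomial_edge_ideal :: "'v set \<times> 'v set set \<Rightarrow> ('v, 'k::field) edge_poly set" where
  "binomial_edge_ideal G =
     Idl\<^bsub>graph_ring G\<^esub> {x_var a * y_var b - x_var b * y_var a | a b. {a, b} \<in> snd G}"


section \<open>The bipartite complement of the cycle of length \<open>2n\<close>\<close>

datatype vertex = U nat | V nat

definition bip_compl_cycle :: "nat \<Rightarrow> vertex set \<times> vertex set set" where
  "bip_compl_cycle n =
     (U ` {..<n} \<union> V ` {..<n},
      {{U i, V j} | i j. i < n \<and> j < n \<and>
         \<not> [int j = int i] (mod int n) \<and> \<not> [int j = int i - 1] (mod int n)})"


section \<open>Sanity checks\<close>

lemma ht_attained:
  assumes "ht R I = enat m"
  shows "\<exists>P \<in> minimal_primes R I. prime_height R P = enat m"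
proof -
  have "prime_height R ` minimal_primes R I \<noteq> {}"
    using assms by (auto simp: ht_def top_enat_def)
  then obtain h where "h \<in> prime_height R ` minimal_primes R I"
    by blast
  then have "Inf (prime_height R ` minimal_primes R I) \<in> prime_height R ` minimal_primes R I"
    by (rule wellorder_InfI)
  then show ?thesis
    using assms by (auto simp: ht_def)
qed

lemma bight_attained:
  assumes "bight R I = enat m" "m > 0"
  shows "\<exists>P \<in> minimal_primes R I. prime_height R P = enat m"
proof -
  let ?A = "prime_height R ` minimal_primes R I"
  have "Sup ?A = enat m" using assms by (simp add: bight_def)
  then have "finite ?A" "?A \<noteq> {}" "Max ?A = enat m"
    using assms(2) by (auto simp: Sup_enat_def zero_enat_def split: if_splits)
  then have "enat m \<in> ?A" using Max_in by metis
  then show ?thesis by auto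
qed

lemma finite_simple_graph_bip_compl_cycle: "finite_simple_graph (bip_compl_cycle n)"
proof -
  have "e \<subseteq> fst (bip_compl_cycle n) \<and> card e = 2" if "e \<in> snd (bip_compl_cycle n)" for e
  proof -
    from that obtain i j where "e = {U i, V j}" "i < n" "j < n"
      unfolding bip_compl_cycle_def snd_conv by blast
    then show ?thesis
      by (simp add: bip_compl_cycle_def)
  qed
  then show ?thesis
    by (simp add: finite_simple_graph_def) (simp add: bip_compl_cycle_def)
qed

lemma indets_mult: "indets (p * q) \<subseteq> indets p \<union> indets q"
proof
  fix z assume "z \<in> indets (p * q)"
  then obtain m where "m \<in> Poly_Mapping.keys (p * q)" and z: "z \<in> Poly_Mapping.keys m"
    by (auto simp: indets_def)
  then obtain a b where "m = a + b" "a \<in> Poly_Mapping.keys p" "b \<in> Poly_Mapping.keys q"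
    using keys_mult[of p q] by blast
  then show "z \<in> indets p \<union> indets q"
    using z Poly_Mapping.keys_add[of a b] by (auto simp: indets_def)
qed

lemma indets_add: "indets (p + q) \<subseteq> indets p \<union> indets q"
  unfolding indets_def using Poly_Mapping.keys_add[of p q] by blast

lemma indets_uminus: "indets (- p) = indets p"
  by (simp add: indets_def)

lemma cring_poly_ring: "cring (poly_ring W :: ('v, 'k::field) edge_poly ring)" (is "cring ?R")
proof -
  have mem: "p \<in> carrier ?R \<longleftrightarrow> indets p \<subseteq> XVar ` W \<union> YVar ` W" for p
    by (simp add: poly_ring_def)
  have ops: "p \<otimes>\<^bsub>?R\<^esub> q = p * q" "p \<oplus>\<^bsub>?R\<^esub> q = p + q" "\<one>\<^bsub>?R\<^esub> = 1" "\<zero>\<^bsub>?R\<^esub> = 0" for p q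
    by (simp_all add: poly_ring_def)
  have add: "p + q \<in> carrier ?R" and mult: "p * q \<in> carrier ?R"
    if "p \<in> carrier ?R" "q \<in> carrier ?R" for p q
    using that indets_add[of p q] indets_mult[of p q] unfolding mem by blast+
  have const: "0 \<in> carrier ?R" "1 \<in> carrier ?R"
    by (simp_all add: mem indets_def)
  have inv: "- p \<in> carrier ?R" if "p \<in> carrier ?R" for p
    using that by (simp add: mem indets_uminus)
  have "abelian_group ?R"
  proof (rule abelian_groupI, unfold ops)
    show "\<exists>q \<in> carrier ?R. q + p = 0" if "p \<in> carrier ?R" for p
      using inv[OF that] by (intro bexI[of _ "- p"]) simp_all
  qed (simp_all add: add const ac_simps)
  moreover have "comm_monoid ?R"
    by (rule comm_monoidI, unfold ops) (simp_all add: mult const ac_simps)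
  ultimately show ?thesis
    by (rule cringI) (simp add: ops distrib_right)
qed

lemma edge_generators_subset_carrier:
  assumes "finite_simple_graph G"
  shows "{x_var a * y_var b - x_var b * y_var a | a b. {a, b} \<in> snd G}
           \<subseteq> carrier (graph_ring G :: ('v, 'k::field) edge_poly ring)"
proof
  fix p :: "('v, 'k) edge_poly"
  assume "p \<in> {x_var a * y_var b - x_var b * y_var a | a b. {a, b} \<in> snd G}"
  then obtain a b where p: "p = x_var a * y_var b + - (x_var b * y_var a)" and e: "{a, b} \<in> snd G"
    by auto
  have ab: "a \<in> fst G" "b \<in> fst G"
    using assms e by (auto simp: finite_simple_graph_def)
  have v: "indets (indet_poly z :: ('v, 'k) edge_poly) = {z}" for z
    by (simp add: indets_def indet_poly_def)
  have "indets p \<subseteq> {XVar a, YVar b, XVar b, YVar a}"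
    unfolding p using indets_add[of "x_var a * y_var b" "- (x_var b * y_var a) :: ('v, 'k) edge_poly"]
      indets_mult[of "x_var a :: ('v, 'k) edge_poly" "y_var b"]
      indets_mult[of "x_var b :: ('v, 'k) edge_poly" "y_var a"]
    by (auto simp: indets_uminus v)
  then show "p \<in> carrier (graph_ring G)"
    using ab by (auto simp: poly_ring_def)
qed

end

theory Submission
  imports Defs "HOL-Library.Countable"
begin

text \<open>
  Let \<open>W\<close> be the vertex set of a graph \<open>G\<close>, with \<open>N\<close> elements, and read a point of the affine space
  with coordinates \<open>x_v\<close>, \<open>y_v\<close> as a family of plane vectors, one for each vertex.  The generators of
  \<open>J_G\<close> say that the vectors of adjacent vertices are parallel.  Being parallel is transitive as long as
  no zero vector intervenes.  So once the set \<open>S\<close> of vertices with zero vector is fixed, all vectors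
  in a connected component of \<open>G - S\<close> are parallel to each other.

  \<^bold>\<open>The primes.\<close>  Let \<open>P_S\<close> be the ideal of polynomials vanishing on all families that are zero on \<open>S\<close>
  and parallel along each component \<open>C\<close> of \<open>G - S\<close>.  Such families are parametrised by a direction for
  each component and a scalar for each vertex, so \<open>P_S\<close> is the kernel of
  \<open>x_v \<mapsto> a_v b_C\<close>, \<open>y_v \<mapsto> a_v c_C\<close> (\<open>parallel_prime\<close>, \<open>component_prime\<close>).  As a kernel into a domain it
  is prime.  If \<open>Q\<close> is any prime containing \<open>J_G\<close> and \<open>S\<close> is the
  set of vertices whose two variables lie in \<open>Q\<close>, then the generic point of \<open>Q\<close> is a family of this
  kind, whence \<open>P_S \<subseteq> Q\<close> (\<open>parallel_prime_subset_prime\<close>).  Therefore the minimal primes are the minimal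
  ones among the \<open>P_S\<close>, and these belong to the sets \<open>S\<close> each of whose elements has neighbours in two
  different components of \<open>G - S\<close> (\<open>minimal_primes_binomial_edge_ideal\<close>).

  \<^bold>\<open>Their heights.\<close>  If \<open>c(S)\<close> is the number of components of \<open>G - S\<close>, the height of \<open>P_S\<close> is
  \<open>N + |S| - c(S)\<close> (\<open>prime_height_parallel_prime\<close>).  Starting from \<open>N\<close> independent directions, \<open>P_S\<close> is
  reached by \<open>N - c(S)\<close> fusions of two classes of parallel vectors and \<open>|S|\<close> deletions of a vertex, and
  each of these operations enlarges the prime.  Continuing in the same way up to the ideal of all
  variables takes \<open>2N - (N + |S| - c(S))\<close> further steps.  Hence a longer chain below \<open>P_S\<close> would give a
  chain of more than \<open>2N\<close> inclusions of primes in a polynomial ring in \<open>2N\<close> variables.  There is none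
  (\<open>prime_chain_length_le\<close>): elements \<open>f_i\<close> of each prime outside the preceding one are algebraically
  independent (\<open>alg_indep_step\<close>), and counting monomials of bounded degree shows that there are not more
  independent polynomials than variables (\<open>alg_indep_card_le\<close>).

  \<^bold>\<open>The graph.\<close>  It remains to bound \<open>|S| - c(S)\<close> over the cut sets \<open>S\<close> of the bipartite complement of
  a cycle of length \<open>2n\<close>, where \<open>N = 2n\<close>.  A Hamiltonian path, cut at \<open>|S|\<close> vertices, falls into at most
  \<open>|S| + 1\<close> pieces; so \<open>c(S) \<le> |S| + 1\<close>, with equality for \<open>S = {}\<close>, and the smallest height is \<open>2n - 1\<close>.
  For the largest height, the remaining vertices and the components of \<open>G - S\<close> are together at least
  \<open>8\<close> in number (\<open>eight_le_remaining_plus_components\<close>), so that \<open>|S| - c(S) \<le> 2n - 8\<close>.  Equality holds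
  when only \<open>u_1, u_2, v_0, v_1, v_2\<close> remain, where the components are \<open>{u_1, v_2}\<close>, \<open>{u_2, v_0}\<close> and \<open>{v_1}\<close>.
\<close>


section \<open>Substitution in polynomial rings\<close>

type_synonym ('i, 'k) mpoly = "('i \<Rightarrow>\<^sub>0 nat) \<Rightarrow>\<^sub>0 'k"

abbreviation const :: "'k \<Rightarrow> ('i, 'k::comm_ring_1) mpoly" where
  "const c \<equiv> Poly_Mapping.single 0 c"

definition var :: "'i \<Rightarrow> ('i, 'k::comm_ring_1) mpoly" where
  "var i = Poly_Mapping.single (Poly_Mapping.single i 1) 1"

definition vars :: "('i, 'k::comm_ring_1) mpoly \<Rightarrow> 'i set" where
  "vars p = (\<Union>m \<in> Poly_Mapping.keys p. Poly_Mapping.keys m)"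

definition mono_val :: "('i \<Rightarrow> 'c::comm_monoid_mult) \<Rightarrow> ('i \<Rightarrow>\<^sub>0 nat) \<Rightarrow> 'c" where
  "mono_val f m = (\<Prod>i \<in> Poly_Mapping.keys m. f i ^ Poly_Mapping.lookup m i)"

text \<open>
  Kept apart from its multiplicative special case, substitution, because the comparison of \<open>P_S\<close> with
  other primes uses such a linear map that is not a ring homomorphism.
\<close>

definition lin_ext :: "('m \<Rightarrow> ('j, 'k::comm_ring_1) mpoly) \<Rightarrow> ('m \<Rightarrow>\<^sub>0 'k) \<Rightarrow> ('j, 'k) mpoly" where
  "lin_ext g p = (\<Sum>m \<in> Poly_Mapping.keys p. const (Poly_Mapping.lookup p m) * g m)"

definition subst :: "('i \<Rightarrow> ('j, 'k::comm_ring_1) mpoly) \<Rightarrow> ('i, 'k) mpoly \<Rightarrow> ('j, 'k) mpoly" where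
  "subst f = lin_ext (mono_val f)"

lemma poly_mapping_sum_single:
  "p = (\<Sum>m \<in> Poly_Mapping.keys p. Poly_Mapping.single m (Poly_Mapping.lookup p m))"
  by (rule poly_mapping_eqI)
     (auto simp: lookup_sum lookup_single when_def in_keys_iff if_distrib cong: if_cong)

lemma poly_mapping_induct_add [case_names zero single add]:
  fixes p :: "'m \<Rightarrow>\<^sub>0 'k::comm_monoid_add"
  assumes "P 0" "\<And>m c. m \<in> Poly_Mapping.keys p \<Longrightarrow> P (Poly_Mapping.single m c)"
    "\<And>q r. P q \<Longrightarrow> P r \<Longrightarrow> P (q + r)"
  shows "P p"
proof -
  have "P (\<Sum>m \<in> A. Poly_Mapping.single m (Poly_Mapping.lookup p m))"
    if "finite A" "A \<subseteq> Poly_Mapping.keys p" for A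
    using that by (induction A rule: finite_induct) (use assms in auto)
  from this[of "Poly_Mapping.keys p"] show ?thesis
    using poly_mapping_sum_single[of p] by simp
qed

lemma const_mult: "const (c * d) = (const c * const d :: ('i, 'k::comm_ring_1) mpoly)"
  by (simp add: mult_single)

lemma const_add: "const (c + d) = (const c + const d :: ('i, 'k::comm_ring_1) mpoly)"
  by (simp add: single_add)

lemma const_mult_single: "const c * Poly_Mapping.single m d = Poly_Mapping.single m (c * d)"
  for c :: "'k::comm_ring_1" and m :: "'i \<Rightarrow>\<^sub>0 nat"
  by (simp add: mult_single)

lemma mono_val_superset:
  assumes "finite A" "Poly_Mapping.keys m \<subseteq> A"
  shows "mono_val f m = (\<Prod>i \<in> A. f i ^ Poly_Mapping.lookup m i)"
  unfolding mono_val_def using assms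
  by (intro prod.mono_neutral_left) (auto simp: in_keys_iff)

lemma mono_val_0 [simp]: "mono_val f 0 = 1"
  by (simp add: mono_val_def)

lemma mono_val_single [simp]: "mono_val f (Poly_Mapping.single i k) = f i ^ k"
  by (simp add: mono_val_def)

lemma mono_val_add: "mono_val f (m + m') = mono_val f m * mono_val f m'"
proof -
  let ?A = "Poly_Mapping.keys m \<union> Poly_Mapping.keys m'"
  have "Poly_Mapping.keys (m + m') \<subseteq> ?A" by (rule Poly_Mapping.keys_add)
  then show ?thesis
    by (simp add: mono_val_superset[of ?A] lookup_add power_add prod.distrib)
qed

lemma mono_val_cong:
  "(\<And>i. i \<in> Poly_Mapping.keys m \<Longrightarrow> f i = g i) \<Longrightarrow> mono_val f m = mono_val g m"
  by (simp add: mono_val_def)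

lemma lin_ext_superset:
  assumes "finite A" "Poly_Mapping.keys p \<subseteq> A"
  shows "lin_ext g p = (\<Sum>m \<in> A. const (Poly_Mapping.lookup p m) * g m)"
  unfolding lin_ext_def using assms
  by (intro sum.mono_neutral_left) (auto simp: in_keys_iff)

lemma lin_ext_add: "lin_ext g (p + q) = lin_ext g p + lin_ext g q"
proof -
  let ?A = "Poly_Mapping.keys p \<union> Poly_Mapping.keys q"
  have "Poly_Mapping.keys (p + q) \<subseteq> ?A" by (rule Poly_Mapping.keys_add)
  then show ?thesis
    by (simp add: lin_ext_superset[of ?A] lookup_add const_add distrib_right sum.distrib)
qed

lemma lin_ext_0 [simp]: "lin_ext g 0 = 0"
  by (simp add: lin_ext_def)

lemma lin_ext_single [simp]: "lin_ext g (Poly_Mapping.single m c) = const c * g m"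
  by (simp add: lin_ext_def)

lemma lin_ext_const_mult: "lin_ext g (const c * p) = const c * lin_ext g p"
  for p :: "('i, 'k::comm_ring_1) mpoly"
  by (induction p rule: poly_mapping_induct_add)
     (simp_all add: lin_ext_add distrib_left mult_single mult.assoc [symmetric])

lemma subst_0 [simp]: "subst f 0 = 0"
  by (simp add: subst_def)

lemma subst_single: "subst f (Poly_Mapping.single m c) = const c * mono_val f m"
  by (simp add: subst_def)

lemma subst_const [simp]: "subst f (const c) = const c"
  by (simp add: subst_single)

lemma subst_1 [simp]: "subst f 1 = 1"
  using subst_const[of f 1] by simp

lemma subst_var [simp]: "subst f (var i) = f i"
  by (simp add: var_def subst_single)

lemma subst_add: "subst f (p + q) = subst f p + subst f q"
  by (simp add: subst_def lin_ext_add)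

lemma subst_uminus: "subst f (- p) = - subst f p"
  by (simp add: eq_neg_iff_add_eq_0 subst_add [symmetric])

lemma subst_diff: "subst f (p - q) = subst f p - subst f q"
  using subst_add[of f p "- q"] by (simp add: subst_uminus)

lemma subst_sum: "subst f (sum g A) = (\<Sum>a\<in>A. subst f (g a))"
  by (induction A rule: infinite_finite_induct) (simp_all add: subst_add)

lemma subst_mult: "subst f (p * q) = subst f p * subst f q"
proof (induction p rule: poly_mapping_induct_add)
  case (single m c)
  show ?case
  proof (induction q rule: poly_mapping_induct_add)
    case (single n d)
    have "subst f (Poly_Mapping.single m c * Poly_Mapping.single n d)
        = const (c * d) * (mono_val f m * mono_val f n)"
      by (simp add: mult_single subst_single mono_val_add)
    also have "\<dots> = subst f (Poly_Mapping.single m c) * subst f (Poly_Mapping.single n d)"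
      unfolding subst_single const_mult by (simp only: ac_simps)
    finally show ?case .
  qed (simp_all add: subst_add distrib_left)
qed (simp_all add: subst_add distrib_right)

lemma subst_power: "subst f (p ^ n) = subst f p ^ n"
  by (induction n) (simp_all add: subst_mult)

lemma subst_prod: "subst f (prod g A) = (\<Prod>a\<in>A. subst f (g a))"
  by (induction A rule: infinite_finite_induct) (simp_all add: subst_mult)

lemma subst_mono_val: "subst g (mono_val f m) = mono_val (\<lambda>i. subst g (f i)) m"
  by (simp add: mono_val_def subst_prod subst_power)

lemma subst_subst: "subst g (subst f p) = subst (\<lambda>i. subst g (f i)) p"
  by (induction p rule: poly_mapping_induct_add)
     (simp_all add: subst_add subst_single subst_mult subst_mono_val)

lemma subst_cong:
  assumes "\<And>i. i \<in> vars p \<Longrightarrow> f i = g i"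
  shows "subst f p = subst g p"
  unfolding subst_def lin_ext_def
  by (intro sum.cong refl arg_cong2[of _ _ _ _ times] mono_val_cong assms) (auto simp: vars_def)

lemma var_power: "var i ^ k = (Poly_Mapping.single (Poly_Mapping.single i k) 1 :: ('i, 'k::comm_ring_1) mpoly)"
  by (induction k) (simp_all add: var_def mult_single single_add [symmetric])

lemma mono_val_var: "mono_val var m = (Poly_Mapping.single m 1 :: ('i, 'k::comm_ring_1) mpoly)"
  by (induction m rule: poly_mapping_induct_add) (simp_all add: mono_val_add var_power mult_single)

lemma mono_val_closed:
  assumes "1 \<in> A" "\<And>a b. a \<in> A \<Longrightarrow> b \<in> A \<Longrightarrow> a * b \<in> A"
    and "\<And>i. i \<in> Poly_Mapping.keys m \<Longrightarrow> f i \<in> A"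
  shows "mono_val f m \<in> A"
proof -
  have pow: "x ^ k \<in> A" if "x \<in> A" for x and k :: nat
    using that by (induction k) (auto intro: assms)
  have "(\<Prod>i\<in>I. f i ^ Poly_Mapping.lookup m i) \<in> A"
    if "finite I" "I \<subseteq> Poly_Mapping.keys m" for I
    using that by (induction I rule: finite_induct) (auto intro!: assms pow)
  then show ?thesis by (simp add: mono_val_def)
qed

lemma lin_ext_closed:
  assumes "0 \<in> A" "\<And>a b. a \<in> A \<Longrightarrow> b \<in> A \<Longrightarrow> a + b \<in> A"
    and "\<And>m c. m \<in> Poly_Mapping.keys p \<Longrightarrow> const c * g m \<in> A"
  shows "lin_ext g p \<in> A"
  by (induction p rule: poly_mapping_induct_add) (auto simp: lin_ext_add intro: assms)

lemma vars_add: "vars (p + q) \<subseteq> vars p \<union> vars q"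
  unfolding vars_def using Poly_Mapping.keys_add[of p q] by blast

lemma vars_mult: "vars (p * q) \<subseteq> vars p \<union> vars q"
proof
  fix z assume "z \<in> vars (p * q)"
  then obtain m where "m \<in> Poly_Mapping.keys (p * q)" and z: "z \<in> Poly_Mapping.keys m"
    by (auto simp: vars_def)
  then obtain a b where "m = a + b" "a \<in> Poly_Mapping.keys p" "b \<in> Poly_Mapping.keys q"
    using keys_mult[of p q] by blast
  then show "z \<in> vars p \<union> vars q"
    using z Poly_Mapping.keys_add[of a b] by (auto simp: vars_def)
qed

lemma vars_0 [simp]: "vars 0 = {}" and vars_const [simp]: "vars (const c) = {}"
  by (auto simp: vars_def split: if_splits)

lemma vars_single: "vars (Poly_Mapping.single m c) \<subseteq> Poly_Mapping.keys m"
  by (auto simp: vars_def split: if_splits)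


section \<open>Prime ideals of the polynomial ring\<close>

lemma indets_eq_vars: "indets p = vars p"
  by (simp add: indets_def vars_def)

lemma indet_poly_eq_var: "indet_poly z = var z"
  by (simp add: indet_poly_def var_def)

lemma vars_1 [simp]: "vars (1 :: ('i, 'k::comm_ring_1) mpoly) = {}"
  by (simp add: vars_def)

lemma vars_var [simp]: "vars (var i :: ('i, 'k::comm_ring_1) mpoly) = {i}"
  by (simp add: vars_def var_def)

lemma carrier_poly_ring: "p \<in> carrier (poly_ring W) \<longleftrightarrow> vars p \<subseteq> XVar ` W \<union> YVar ` W"
  by (simp add: poly_ring_def indets_eq_vars)

lemma poly_ring_simps [simp]:
  "monoid.mult (poly_ring W) = (*)" "one (poly_ring W) = 1"
  "zero (poly_ring W) = 0" "add (poly_ring W) = (+)"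
  by (simp_all add: poly_ring_def)

lemma carrier_const [simp]: "const c \<in> carrier (poly_ring W)"
  by (simp add: carrier_poly_ring)

lemma carrier_0 [simp]: "0 \<in> carrier (poly_ring W)"
  by (simp add: carrier_poly_ring)

lemma carrier_1 [simp]: "1 \<in> carrier (poly_ring W)"
  using carrier_const[of 1 W] by simp

lemma carrier_add: "p \<in> carrier (poly_ring W) \<Longrightarrow> q \<in> carrier (poly_ring W) \<Longrightarrow> p + q \<in> carrier (poly_ring W)"
  using vars_add[of p q] by (auto simp: carrier_poly_ring)

lemma carrier_mult: "p \<in> carrier (poly_ring W) \<Longrightarrow> q \<in> carrier (poly_ring W) \<Longrightarrow> p * q \<in> carrier (poly_ring W)"
  using vars_mult[of p q] by (auto simp: carrier_poly_ring)

lemma carrier_uminus: "p \<in> carrier (poly_ring W) \<Longrightarrow> - p \<in> carrier (poly_ring W)"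
  by (simp add: carrier_poly_ring vars_def)

lemma carrier_diff: "p \<in> carrier (poly_ring W) \<Longrightarrow> q \<in> carrier (poly_ring W) \<Longrightarrow> p - q \<in> carrier (poly_ring W)"
  using carrier_add[of p W "- q"] by (simp add: carrier_uminus)

lemma carrier_power: "p \<in> carrier (poly_ring W) \<Longrightarrow> p ^ n \<in> carrier (poly_ring W)"
  by (induction n) (simp_all add: carrier_mult)

lemma carrier_prod:
  "(\<And>a. a \<in> A \<Longrightarrow> g a \<in> carrier (poly_ring W)) \<Longrightarrow> prod g A \<in> carrier (poly_ring W)"
  by (induction A rule: infinite_finite_induct) (simp_all add: carrier_mult)

lemma carrier_sum:
  "(\<And>a. a \<in> A \<Longrightarrow> g a \<in> carrier (poly_ring W)) \<Longrightarrow> sum g A \<in> carrier (poly_ring W)"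
  by (induction A rule: infinite_finite_induct) (simp_all add: carrier_add)

lemma carrier_var: "v \<in> W \<Longrightarrow> x_var v \<in> carrier (poly_ring W)" "v \<in> W \<Longrightarrow> y_var v \<in> carrier (poly_ring W)"
  by (auto simp: carrier_poly_ring indet_poly_eq_var)

lemma carrier_mono_val:
  assumes "\<And>i. i \<in> Poly_Mapping.keys m \<Longrightarrow> f i \<in> carrier (poly_ring W)"
  shows "mono_val f m \<in> carrier (poly_ring W)"
  by (rule mono_val_closed) (auto intro: carrier_mult assms)

lemma carrier_subst:
  assumes "\<And>i. i \<in> vars p \<Longrightarrow> f i \<in> carrier (poly_ring W)"
  shows "subst f p \<in> carrier (poly_ring W)"
  unfolding subst_def
  by (rule lin_ext_closed) (auto intro!: carrier_add carrier_mult carrier_mono_val assms simp: vars_def)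

lemma primeideal_poly_ringD:
  assumes "primeideal Q (poly_ring W :: ('v, 'k::field) edge_poly ring)"
  shows prime_carrier: "q \<in> Q \<Longrightarrow> q \<in> carrier (poly_ring W)"
    and prime_0: "0 \<in> Q"
    and prime_add: "q \<in> Q \<Longrightarrow> r \<in> Q \<Longrightarrow> q + r \<in> Q"
    and prime_mult: "p \<in> carrier (poly_ring W) \<Longrightarrow> q \<in> Q \<Longrightarrow> p * q \<in> Q"
    and prime_uminus: "q \<in> Q \<Longrightarrow> - q \<in> Q"
    and prime_diff: "q \<in> Q \<Longrightarrow> r \<in> Q \<Longrightarrow> q - r \<in> Q"
    and prime_1: "1 \<notin> Q"
    and prime_prime: "p \<in> carrier (poly_ring W) \<Longrightarrow> q \<in> carrier (poly_ring W) \<Longrightarrow> p * q \<in> Q \<Longrightarrow> p \<in> Q \<or> q \<in> Q"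
proof -
  interpret primeideal Q "poly_ring W :: ('v, 'k) edge_poly ring" by fact
  show "q \<in> carrier (poly_ring W)" if "q \<in> Q" using a_subset that by blast
  show "0 \<in> Q" using additive_subgroup.zero_closed[OF is_additive_subgroup] by simp
  show add: "q + r \<in> Q" if "q \<in> Q" "r \<in> Q" for q r using additive_subgroup.a_closed[OF is_additive_subgroup that] by simp
  show mult: "p * q \<in> Q" if "p \<in> carrier (poly_ring W)" "q \<in> Q" for p q
    using I_l_closed[OF that(2) that(1)] by simp
  show um: "- q \<in> Q" if "q \<in> Q" for q
    using mult[OF _ that, of "- 1"] by (simp add: carrier_uminus)
  show "q - r \<in> Q" if "q \<in> Q" "r \<in> Q" using add[OF that(1) um[OF that(2)]] by simp
  show "1 \<notin> Q" using one_imp_carrier I_notcarr by auto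
  show "p \<in> Q \<or> q \<in> Q" if "p \<in> carrier (poly_ring W)" "q \<in> carrier (poly_ring W)" "p * q \<in> Q"
    using I_prime[of p q] that by simp
qed

lemma primeideal_poly_ringI:
  fixes Q :: "('v, 'k::field) edge_poly set"
  assumes "Q \<subseteq> carrier (poly_ring W)" "0 \<in> Q" "\<And>p q. p \<in> Q \<Longrightarrow> q \<in> Q \<Longrightarrow> p + q \<in> Q"
    and mult: "\<And>p q. p \<in> carrier (poly_ring W) \<Longrightarrow> q \<in> Q \<Longrightarrow> p * q \<in> Q"
    and "1 \<notin> Q"
    and "\<And>p q. p \<in> carrier (poly_ring W) \<Longrightarrow> q \<in> carrier (poly_ring W) \<Longrightarrow> p * q \<in> Q \<Longrightarrow> p \<in> Q \<or> q \<in> Q"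
  shows "primeideal Q (poly_ring W)"
proof -
  interpret cring "poly_ring W :: ('v, 'k) edge_poly ring" by (rule cring_poly_ring)
  have um: "- q \<in> Q" if "q \<in> Q" for q
    using mult[OF _ that, of "- 1"] by (simp add: carrier_uminus)
  have inv: "\<ominus>\<^bsub>poly_ring W\<^esub> q = - q" if "q \<in> Q" for q
    using minus_equality[of "- q" q] that assms(1) by (auto simp: carrier_uminus)
  show ?thesis
  proof (rule primeidealI)
    show "ideal Q (poly_ring W)"
    proof (rule idealI)
      show "ring (poly_ring W :: ('v, 'k) edge_poly ring)" by (rule ring_axioms)
      show "subgroup Q (add_monoid (poly_ring W))"
        by (rule add.subgroupI) (use assms inv um in \<open>auto simp: a_inv_def [symmetric]\<close>)
      fix a x :: "('v, 'k) edge_poly"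
      assume "a \<in> Q" "x \<in> carrier (poly_ring W)"
      then have "x * a \<in> Q" using mult by blast
      then show "x \<otimes>\<^bsub>poly_ring W\<^esub> a \<in> Q" "a \<otimes>\<^bsub>poly_ring W\<^esub> x \<in> Q"
        by (simp_all add: mult.commute)
    qed
    show "cring (poly_ring W :: ('v, 'k) edge_poly ring)" by (rule cring_poly_ring)
    show "carrier (poly_ring W) \<noteq> Q" using assms(5) carrier_1 by blast
  qed (use assms in auto)
qed

lemma prime_not_in_mult:
  assumes "primeideal Q (poly_ring W)" "p \<in> carrier (poly_ring W)" "q \<in> carrier (poly_ring W)"
    "p \<notin> Q" "q \<notin> Q"
  shows "p * q \<notin> Q"
  using prime_prime[OF assms(1-3)] assms by blast

lemma prime_not_in_power:
  assumes "primeideal Q (poly_ring W)" "p \<in> carrier (poly_ring W)" "p \<notin> Q"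
  shows "p ^ n \<notin> Q"
  by (induction n) (simp_all add: assms prime_1[OF assms(1)] carrier_power prime_not_in_mult[OF assms(1)])

lemma prime_not_in_prod:
  assumes Q: "primeideal Q (poly_ring W)"
    and "\<And>a. a \<in> A \<Longrightarrow> g a \<in> carrier (poly_ring W)" "\<And>a. a \<in> A \<Longrightarrow> g a \<notin> Q"
  shows "prod g A \<notin> Q"
  using assms(2,3)
  by (induction A rule: infinite_finite_induct)
     (simp_all add: prime_1[OF Q] prime_not_in_mult[OF Q] carrier_prod)


section \<open>The dimension of the polynomial ring\<close>

definition alg_indep :: "('j, 'k::comm_ring_1) mpoly set \<Rightarrow> nat \<Rightarrow> (nat \<Rightarrow> ('j, 'k) mpoly) \<Rightarrow> bool" where
  "alg_indep P r a \<longleftrightarrow> (\<forall>F. vars F \<subseteq> {..<r} \<longrightarrow> subst a F \<in> P \<longrightarrow> F = 0)"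

text \<open>
  All sufficiently large bounds \<open>K\<close> are allowed so that two such expansions can be added termwise.
\<close>

lemma polynomial_in_last_var:
  fixes F :: "(nat, 'k::comm_ring_1) mpoly"
  assumes "vars F \<subseteq> {..<Suc r}"
  shows "\<exists>G J. (\<forall>j. vars (G j) \<subseteq> {..<r}) \<and> (\<forall>K\<ge>J. F = (\<Sum>j<K. var r ^ j * G j))"
proof (induction F rule: poly_mapping_induct_add)
  case zero
  then show ?case by (intro exI[of _ "\<lambda>_. 0"]) simp
next
  case (single m c)
  define m' where "m' = Poly_Mapping.update r 0 m"
  define k where "k = Poly_Mapping.lookup m r"
  define G where "G = (\<lambda>j. if j = k then Poly_Mapping.single m' c else 0)"
  have m: "m = Poly_Mapping.single r k + m'"
    by (rule poly_mapping_eqI) (auto simp: m'_def k_def lookup_add lookup_update lookup_single when_def)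
  have "Poly_Mapping.keys m \<subseteq> {..<Suc r}" using single assms by (auto simp: vars_def)
  then have "Poly_Mapping.keys m' \<subseteq> {..<r}"
    by (auto simp: m'_def keys_update less_Suc_eq)
  then have "\<forall>j. vars (G j) \<subseteq> {..<r}"
    using vars_single[of m' c] by (auto simp: G_def)
  moreover have "Poly_Mapping.single m c = (\<Sum>j<K. var r ^ j * G j)" if "K \<ge> Suc k" for K
  proof -
    have "(\<Sum>j<K. var r ^ j * G j) = (\<Sum>j<K. if j = k then var r ^ k * Poly_Mapping.single m' c else 0)"
      by (rule sum.cong) (auto simp: G_def)
    also have "\<dots> = var r ^ k * Poly_Mapping.single m' c" using that by simp
    also have "\<dots> = Poly_Mapping.single m c" by (simp add: var_power mult_single m)
    finally show ?thesis by simp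
  qed
  ultimately show ?case by blast
next
  case (add q q')
  then obtain G J G' J' where
    G: "\<And>j. vars (G j) \<subseteq> {..<r}" "\<And>K. K \<ge> J \<Longrightarrow> q = (\<Sum>j<K. var r ^ j * G j)"
    and G': "\<And>j. vars (G' j) \<subseteq> {..<r}" "\<And>K. K \<ge> J' \<Longrightarrow> q' = (\<Sum>j<K. var r ^ j * G' j)"
    by blast
  have "vars (G j + G' j) \<subseteq> {..<r}" for j
    using vars_add[of "G j" "G' j"] G(1)[of j] G'(1)[of j] by blast
  moreover have "q + q' = (\<Sum>j<K. var r ^ j * (G j + G' j))" if "K \<ge> max J J'" for K
    using G(2)[of K] G'(2)[of K] that by (simp add: distrib_left sum.distrib)
  ultimately show ?case by (intro exI[of _ "\<lambda>j. G j + G' j"] exI[of _ "max J J'"]) blast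
qed

text \<open>
  The sum and every term with \<open>j > 0\<close> lie in \<open>Q\<close>, because \<open>f\<close> does; so the constant term \<open>g 0\<close> lies in \<open>Q\<close>
  and vanishes.  What is left is a multiple of \<open>f\<close> in \<open>P\<close>, and \<open>f\<close> can be cancelled since it is not in \<open>P\<close>.
\<close>

lemma coefficients_in_larger_prime:
  fixes P Q :: "('v, 'k::field) edge_poly set"
  assumes P: "primeideal P (poly_ring W)" and Q: "primeideal Q (poly_ring W)" and "P \<subseteq> Q" "f \<in> Q" "f \<notin> P"
    and "\<And>j. g j \<in> carrier (poly_ring W)" "\<And>j. g j \<in> Q \<Longrightarrow> g j = 0"
    and "(\<Sum>j<J. f ^ j * g j) \<in> P"
  shows "\<forall>j<J. g j = 0"
  using assms(6-)
proof (induction J arbitrary: g)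
  case (Suc J)
  let ?T = "\<Sum>j<J. f ^ j * g (Suc j)"
  have f: "f \<in> carrier (poly_ring W)" using prime_carrier[OF Q] \<open>f \<in> Q\<close> .
  have T: "?T \<in> carrier (poly_ring W)"
    by (intro carrier_sum carrier_mult carrier_power f Suc.prems)
  have sum: "(\<Sum>j<Suc J. f ^ j * g j) = g 0 + f * ?T"
    by (simp add: sum.lessThan_Suc_shift sum_distrib_left mult.assoc del: sum.lessThan_Suc)
  have "f * ?T \<in> Q" using prime_mult[OF Q T \<open>f \<in> Q\<close>] by (simp add: mult.commute)
  then have "g 0 + f * ?T - f * ?T \<in> Q"
    using Suc.prems(3) \<open>P \<subseteq> Q\<close> unfolding sum by (intro prime_diff[OF Q]) auto
  then have g0: "g 0 = 0" using Suc.prems(2) by simp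
  then have "?T \<in> P"
    using Suc.prems(3) prime_prime[OF P f T] \<open>f \<notin> P\<close> unfolding sum by auto
  then have "\<forall>j<J. g (Suc j) = 0" using Suc.IH[of "\<lambda>j. g (Suc j)"] Suc.prems by blast
  then show ?case using g0 by (auto simp: less_Suc_eq_0_disj)
qed simp

text \<open>
  Passing to a strictly smaller prime raises the transcendence degree of the quotient: an element that
  becomes nonzero is independent of the elements that were independent before.
\<close>

lemma alg_indep_step:
  fixes P Q :: "('v, 'k::field) edge_poly set"
  assumes P: "primeideal P (poly_ring W)" and Q: "primeideal Q (poly_ring W)" and "P \<subseteq> Q" "f \<in> Q" "f \<notin> P"
    and a: "\<And>i. i < r \<Longrightarrow> a i \<in> carrier (poly_ring W)" and "alg_indep Q r a"
  shows "alg_indep P (Suc r) (a(r := f))"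
  unfolding alg_indep_def
proof (intro allI impI)
  fix F :: "(nat, 'k) mpoly"
  assume F: "vars F \<subseteq> {..<Suc r}" "subst (a(r := f)) F \<in> P"
  obtain G J where G: "\<And>j. vars (G j) \<subseteq> {..<r}" and FG: "F = (\<Sum>j<J. var r ^ j * G j)"
    using polynomial_in_last_var[OF F(1)] by blast
  define g where "g = (\<lambda>j. subst a (G j))"
  have "subst (a(r := f)) (G j) = g j" for j
    unfolding g_def using G[of j] by (intro subst_cong) auto
  then have "subst (a(r := f)) F = (\<Sum>j<J. f ^ j * g j)"
    by (simp add: FG subst_sum subst_mult subst_power)
  moreover have "g j \<in> carrier (poly_ring W)" for j
    unfolding g_def using G[of j] a by (intro carrier_subst) auto
  moreover have G0: "G j = 0" if "g j \<in> Q" for j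
    using \<open>alg_indep Q r a\<close> G that unfolding alg_indep_def g_def by blast
  then have "g j = 0" if "g j \<in> Q" for j using G0[OF that] by (simp add: g_def)
  ultimately have "\<forall>j<J. g j = 0"
    using F(2) coefficients_in_larger_prime[OF P Q assms(3-5), of g J] by metis
  then have "\<forall>j<J. G j = 0" using G0 prime_0[OF Q] by simp
  then show "F = 0" by (simp add: FG)
qed

lemma card_exponent_box:
  assumes "finite A" "M > 0"
  defines "B \<equiv> {m :: 'i \<Rightarrow>\<^sub>0 nat. Poly_Mapping.keys m \<subseteq> A \<and> (\<forall>i. Poly_Mapping.lookup m i < M)}"
  shows "card B = M ^ card A" "finite B"
proof -
  define g where "g = (\<lambda>f i. if i \<in> A then f i else (0::nat))"
  have fin: "finite {i. g f i \<noteq> 0}" for f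
    by (rule finite_subset[OF _ \<open>finite A\<close>]) (auto simp: g_def)
  have lookup: "Poly_Mapping.lookup (Abs_poly_mapping (g f)) = g f" for f
    by (rule lookup_Abs_poly_mapping[OF fin])
  have "bij_betw (\<lambda>m. restrict (Poly_Mapping.lookup m) A) B (A \<rightarrow>\<^sub>E {..<M})"
  proof (rule bij_betwI[where g = "\<lambda>f. Abs_poly_mapping (g f)"])
    show "(\<lambda>f. Abs_poly_mapping (g f)) \<in> (A \<rightarrow>\<^sub>E {..<M}) \<rightarrow> B"
      using \<open>M > 0\<close> by (auto simp: B_def in_keys_iff lookup)
        (auto simp: g_def split: if_splits)
    show "Abs_poly_mapping (g (restrict (Poly_Mapping.lookup m) A)) = m" if "m \<in> B" for m
      using that by (intro poly_mapping_eqI)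
(simp add: lookup, auto simp: g_def B_def in_keys_iff)
    show "restrict (Poly_Mapping.lookup (Abs_poly_mapping (g f))) A = f" if "f \<in> A \<rightarrow>\<^sub>E {..<M}" for f
      using that unfolding lookup by (auto simp: g_def PiE_def extensional_def)
  qed (auto simp: B_def)
  from bij_betw_same_card[OF this] bij_betw_finite[OF this] \<open>finite A\<close>
  show "card B = M ^ card A" "finite B"
    by (simp_all add: card_PiE finite_PiE)
qed

definition exp_bounded :: "nat \<Rightarrow> ('j, 'k::comm_ring_1) mpoly \<Rightarrow> bool" where
  "exp_bounded d p \<longleftrightarrow> (\<forall>m \<in> Poly_Mapping.keys p. \<forall>z. Poly_Mapping.lookup m z \<le> d)"

lemma exp_bounded_mult: "exp_bounded d p \<Longrightarrow> exp_bounded e q \<Longrightarrow> exp_bounded (d + e) (p * q)"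
  unfolding exp_bounded_def using keys_mult[of p q] by (fastforce simp: lookup_add intro: add_mono)

lemma exp_bounded_1: "exp_bounded 0 1"
  by (simp add: exp_bounded_def)

lemma exp_bounded_power: "exp_bounded d p \<Longrightarrow> exp_bounded (n * d) (p ^ n)"
  by (induction n) (auto simp: exp_bounded_1 intro: exp_bounded_mult)

lemma exp_bounded_mono: "exp_bounded d p \<Longrightarrow> d \<le> e \<Longrightarrow> exp_bounded e p"
  unfolding exp_bounded_def by (meson order_trans)

lemma exp_bounded_prod:
  "finite I \<Longrightarrow> (\<And>i. i \<in> I \<Longrightarrow> exp_bounded d (g i)) \<Longrightarrow> exp_bounded (card I * d) (prod g I)"
  by (induction I rule: finite_induct) (auto simp: exp_bounded_1 intro: exp_bounded_mult)

lemma exp_bounded_exists: "\<exists>d. exp_bounded d p"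
proof -
  define s where "s = (\<Sum>m \<in> Poly_Mapping.keys p. \<Sum>z \<in> Poly_Mapping.keys m. Poly_Mapping.lookup m z)"
  have "Poly_Mapping.lookup m z \<le> s" if "m \<in> Poly_Mapping.keys p" for m z
  proof (cases "z \<in> Poly_Mapping.keys m")
    case True
    then have "Poly_Mapping.lookup m z \<le> (\<Sum>z \<in> Poly_Mapping.keys m. Poly_Mapping.lookup m z)"
      by (intro member_le_sum) auto
    also have "\<dots> \<le> s" unfolding s_def using that by (intro member_le_sum) auto
    finally show ?thesis .
  qed (simp add: in_keys_iff)
  then show ?thesis by (auto simp: exp_bounded_def)
qed

lemma vector_space_mpoly: "vector_space (\<lambda>(c::'k::field) p :: ('j, 'k) mpoly. const c * p)"
  by unfold_locales (simp_all add: distrib_left distrib_right const_add const_mult mult.assoc)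

text \<open>
  If the exponents in the \<open>a i\<close> are at most \<open>d\<close>, the \<open>M ^ r\<close> monomials in the \<open>a i\<close> with exponents below \<open>M\<close>
  are linearly independent in a space of dimension \<open>(r * M * d + 1) ^ card Z\<close>.  For large \<open>M\<close> this is
  possible only if \<open>r \<le> card Z\<close>.
\<close>

lemma alg_indep_card_le:
  fixes a :: "nat \<Rightarrow> ('j, 'k::field) mpoly"
  assumes "finite Z" "0 \<in> P" "\<And>i. i < r \<Longrightarrow> vars (a i) \<subseteq> Z" and ind: "alg_indep P r a"
  shows "r \<le> card Z"
proof (rule ccontr)
  assume "\<not> r \<le> card Z"
  interpret vs: vector_space "\<lambda>(c::'k) p :: ('j, 'k) mpoly. const c * p"
    by (rule vector_space_mpoly)
  have "\<exists>d. \<forall>i<r. exp_bounded d (a i)"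
  proof -
    obtain D where D: "\<And>i. exp_bounded (D i) (a i)"
      using choice[of "\<lambda>i d. exp_bounded d (a i)"] exp_bounded_exists by blast
    have "exp_bounded (\<Sum>i<r. D i) (a i)" if "i < r" for i
      using that by (intro exp_bounded_mono[OF D] member_le_sum) auto
    then show ?thesis by blast
  qed
  then obtain d where d: "\<And>i. i < r \<Longrightarrow> exp_bounded d (a i)" by blast
  \<comment> \<open>Large enough for \<open>M ^ Suc (card Z)\<close> to exceed \<open>(M * (r * d + 1)) ^ card Z\<close>.\<close>
  define M where "M = Suc ((r * d + 1) ^ card Z)"
  define B where "B = {m :: nat \<Rightarrow>\<^sub>0 nat. Poly_Mapping.keys m \<subseteq> {..<r} \<and> (\<forall>i. Poly_Mapping.lookup m i < M)}"
  define C where "C = {m. Poly_Mapping.keys m \<subseteq> Z \<and> (\<forall>i. Poly_Mapping.lookup m i < r * (M * d) + 1)}"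
  have M: "M > 0" by (simp add: M_def)
  have B: "card B = M ^ r" "finite B"
    using card_exponent_box[OF _ M, of "{..<r}"] unfolding B_def by simp_all
  have C: "card C = (r * (M * d) + 1) ^ card Z" "finite C"
    using card_exponent_box[OF \<open>finite Z\<close>, of "r * (M * d) + 1"] unfolding C_def by simp_all
  have comb: "\<forall>m\<in>T. c m = 0" if T: "T \<subseteq> B" "(\<Sum>m\<in>T. const (c m) * mono_val a m) = 0" for T c
  proof -
    have "finite T" using B(2) T(1) finite_subset by blast
    define F where "F = (\<Sum>m\<in>T. Poly_Mapping.single m (c m))"
    have "subst a F = 0" using T(2) by (simp add: F_def subst_sum subst_single)
    moreover have "vars F \<subseteq> {..<r}"
      unfolding F_def vars_def using Poly_Mapping.keys_sum[of "\<lambda>m. Poly_Mapping.single m (c m)" T] T(1)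
      by (fastforce simp: B_def split: if_splits)
    ultimately have "F = 0" using ind \<open>0 \<in> P\<close> unfolding alg_indep_def by auto
    moreover have "Poly_Mapping.lookup F m = c m" if "m \<in> T" for m
      using that \<open>finite T\<close> by (simp add: F_def lookup_sum lookup_single when_def)
    ultimately show ?thesis by simp
  qed
  have inj: "inj_on (mono_val a) B"
  proof (rule inj_onI, rule ccontr)
    fix m m' assume mm: "m \<in> B" "m' \<in> B" "mono_val a m = mono_val a m'" "m \<noteq> m'"
    have "\<forall>l\<in>{m, m'}. (if l = m then 1 else - 1 :: 'k) = 0"
      by (rule comb) (use mm in \<open>auto simp: single_uminus\<close>)
    then show False by simp
  qed
  have "vs.independent (mono_val a ` B)"
  proof
    assume "vs.dependent (mono_val a ` B)"
    then obtain t u v where t: "finite t" "t \<subseteq> mono_val a ` B" "(\<Sum>v\<in>t. const (u v) * v) = 0" "v \<in> t" "u v \<noteq> 0"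
      unfolding vs.dependent_explicit by blast
    obtain T where T: "T \<subseteq> B" "t = mono_val a ` T" using t(2) by (meson subset_imageE)
    have injT: "inj_on (mono_val a) T" using inj T(1) inj_on_subset by blast
    have "\<forall>m\<in>T. u (mono_val a m) = 0"
      by (rule comb[OF T(1)]) (use t(3) injT in \<open>simp add: T(2) sum.reindex\<close>)
    then show False using t T by auto
  qed
  moreover have "mono_val a ` B \<subseteq> vs.span ((\<lambda>m. Poly_Mapping.single m 1) ` C)"
  proof (intro image_subsetI)
    fix m assume m: "m \<in> B"
    have mv: "mono_val a m = (\<Prod>i<r. a i ^ Poly_Mapping.lookup m i)"
      using m by (intro mono_val_superset) (auto simp: B_def)
    have "exp_bounded (card {..<r} * (M * d)) (mono_val a m)"
      unfolding mv
    proof (rule exp_bounded_prod)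
      fix i assume "i \<in> {..<r}"
      then have "exp_bounded (Poly_Mapping.lookup m i * d) (a i ^ Poly_Mapping.lookup m i)"
        using d by (intro exp_bounded_power) auto
      moreover have "Poly_Mapping.lookup m i * d \<le> M * d"
        using m by (intro mult_right_mono) (auto simp: B_def intro: less_imp_le)
      ultimately show "exp_bounded (M * d) (a i ^ Poly_Mapping.lookup m i)"
        by (rule exp_bounded_mono)
    qed simp
    moreover have "mono_val a m \<in> {p. vars p \<subseteq> Z}"
    proof (rule mono_val_closed)
      show "1 \<in> {p :: ('j, 'k) mpoly. vars p \<subseteq> Z}" by simp
      show "p * q \<in> {p. vars p \<subseteq> Z}" if "p \<in> {p. vars p \<subseteq> Z}" "q \<in> {p. vars p \<subseteq> Z}"
        for p q :: "('j, 'k) mpoly"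
        using that vars_mult[of p q] by auto
      show "a i \<in> {p. vars p \<subseteq> Z}" if "i \<in> Poly_Mapping.keys m" for i
        using that m assms(3)[of i] by (auto simp: B_def)
    qed
    ultimately have keys: "Poly_Mapping.keys (mono_val a m) \<subseteq> C"
      by (fastforce simp: exp_bounded_def vars_def C_def less_Suc_eq_le)
    have eq: "mono_val a m = (\<Sum>e \<in> Poly_Mapping.keys (mono_val a m).
        const (Poly_Mapping.lookup (mono_val a m) e) * Poly_Mapping.single e 1)"
      using poly_mapping_sum_single[of "mono_val a m"] by (simp add: mult_single)
    show "mono_val a m \<in> vs.span ((\<lambda>m. Poly_Mapping.single m 1) ` C)"
      by (subst eq, rule vs.span_sum, rule vs.span_scale, rule vs.span_base) (use keys in auto)
  qed
  ultimately have "card (mono_val a ` B) \<le> card ((\<lambda>m. Poly_Mapping.single m (1::'k)) ` C)"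
    using vs.independent_span_bound C(2) by blast
  also have "\<dots> \<le> card C" by (rule card_image_le[OF C(2)])
  finally have "M ^ r \<le> (r * (M * d) + 1) ^ card Z"
    using card_image[OF inj] B C by simp
  also have "\<dots> \<le> (M * (r * d + 1)) ^ card Z"
    using M by (intro power_mono) (auto simp: algebra_simps)
  also have "\<dots> = M ^ card Z * (r * d + 1) ^ card Z" by (rule power_mult_distrib)
  also have "\<dots> < M ^ card Z * M" using M by (simp add: M_def)
  also have "\<dots> = M ^ Suc (card Z)" by simp
  also have "\<dots> \<le> M ^ r" using M \<open>\<not> r \<le> card Z\<close> by (intro power_increasing) auto
  finally show False by simp
qed

definition prime_chain :: "('a, 'b) ring_scheme \<Rightarrow> nat \<Rightarrow> 'a set \<Rightarrow> 'a set \<Rightarrow> bool" where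
  "prime_chain R k P Q \<longleftrightarrow> (\<exists>C. (\<forall>i\<le>k. primeideal (C i) R) \<and> (\<forall>i<k. C i \<subset> C (Suc i)) \<and> C 0 = P \<and> C k = Q)"

text \<open>
  Walking down the chain from the top, every step adds one algebraically independent polynomial.
\<close>

theorem prime_chain_length_le:
  fixes P Q :: "('v, 'k::field) edge_poly set"
  assumes "finite W" "prime_chain (poly_ring W) k P Q"
  shows "k \<le> 2 * card W"
proof -
  let ?R = "poly_ring W :: ('v, 'k) edge_poly ring"
  obtain C where C: "\<And>i. i \<le> k \<Longrightarrow> primeideal (C i) ?R" "\<And>i. i < k \<Longrightarrow> C i \<subset> C (Suc i)"
    using assms(2) unfolding prime_chain_def by blast
  \<comment> \<open>For \<open>j = 0\<close> the claim is that a prime contains no nonzero constant.\<close>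
  have "\<exists>a. (\<forall>i<j. a i \<in> carrier ?R) \<and> alg_indep (C (k - j)) j a" if "j \<le> k" for j
    using that
  proof (induction j)
    case 0
    have "subst a F \<notin> C k" if "vars F = {}" "F \<noteq> 0" for F :: "(nat, 'k) mpoly" and a
    proof
      assume F: "subst a F \<in> C k"
      have "Poly_Mapping.keys F \<subseteq> {0}" using that(1) by (auto simp: vars_def)
      then have Fc: "F = const (Poly_Mapping.lookup F 0)"
        by (intro poly_mapping_eqI) (auto simp: lookup_single when_def in_keys_iff)
      define c where "c = Poly_Mapping.lookup F 0"
      have c: "F = const c" "c \<noteq> 0" using Fc that(2) by (auto simp: c_def)
      have "const (1 / c) * const c \<in> C k"
        using F unfolding c(1) by (intro prime_mult[OF C(1)]) auto
      then show False using c(2) prime_1[OF C(1)[of k]] by (simp add: mult_single)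
    qed
    then show ?case by (auto simp: alg_indep_def)
  next
    case (Suc j)
    then obtain a where a: "\<forall>i<j. a i \<in> carrier ?R" "alg_indep (C (k - j)) j a" by auto
    have k: "Suc (k - Suc j) = k - j" using Suc.prems by simp
    have sub: "C (k - Suc j) \<subset> C (k - j)" using C(2)[of "k - Suc j"] Suc.prems unfolding k by simp
    then obtain f where f: "f \<in> C (k - j)" "f \<notin> C (k - Suc j)" by blast
    have "alg_indep (C (k - Suc j)) (Suc j) (a(j := f))"
      using sub f a C by (intro alg_indep_step[where Q = "C (k - j)" and W = W]) auto
    moreover have "f \<in> carrier ?R" using prime_carrier[OF C(1) f(1)] by simp
    moreover have "\<forall>i<Suc j. (a(j := f)) i \<in> carrier ?R"
      using a(1) \<open>f \<in> carrier ?R\<close> by auto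
    ultimately show ?case by blast
  qed
  from this[of k] obtain a where a: "\<forall>i<k. a i \<in> carrier ?R" "alg_indep (C 0) k a" by auto
  have "k \<le> card (XVar ` W \<union> YVar ` W)"
    using a \<open>finite W\<close> prime_0[OF C(1)[of 0]]
    by (intro alg_indep_card_le[of _ "C 0" k a]) (auto simp: carrier_poly_ring)
  also have "\<dots> \<le> card W + card W"
    using card_Un_le[of "XVar ` W" "YVar ` W"] card_image_le[OF \<open>finite W\<close>] add_mono order_trans by meson
  finally show ?thesis by simp
qed


section \<open>Primes of vectors that are parallel within prescribed classes\<close>

lemma kernel_primeideal:
  fixes f :: "'v indet \<Rightarrow> (nat, 'k::field) mpoly"
  shows "primeideal {p \<in> carrier (poly_ring W). subst f p = 0} (poly_ring W)"
  by (rule primeideal_poly_ringI)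
     (auto simp: subst_add subst_mult intro: carrier_add carrier_mult)

lemma kernel_mono:
  assumes "\<And>i. i \<in> XVar ` W \<union> YVar ` W \<Longrightarrow> g i = subst h (f i)"
  shows "{p \<in> carrier (poly_ring W). subst f p = 0} \<subseteq> {p \<in> carrier (poly_ring W). subst g p = 0}"
proof clarify
  fix p assume p: "p \<in> carrier (poly_ring W)" "subst f p = 0"
  have "subst g p = subst (\<lambda>i. subst h (f i)) p"
    using p(1) by (intro subst_cong assms) (auto simp: carrier_poly_ring)
  also have "\<dots> = 0" using p(2) by (simp add: subst_subst [symmetric])
  finally show "subst g p = 0" .
qed

text \<open>
  A scalar for each vertex, and the two coordinates of a direction for each class of vertices.
\<close>

datatype 'v param = Scale 'v | DirX 'v | DirY 'v

instance param :: (countable) countable by countable_datatype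

text \<open>
  Numbering the parameters makes the target a polynomial ring in variables indexed by naturals, which
  is an integral domain.
\<close>

definition par :: "'v::countable param \<Rightarrow> (nat, 'k::comm_ring_1) mpoly" where
  "par z = var (to_nat z)"

text \<open>
  The classes are the fibres of \<open>\<pi>\<close>; they are named by vertices.
\<close>

fun parallel_param :: "'v::countable set \<Rightarrow> ('v \<Rightarrow> 'v) \<Rightarrow> 'v indet \<Rightarrow> (nat, 'k::field) mpoly" where
  "parallel_param S \<pi> (XVar v) = (if v \<in> S then 0 else par (Scale v) * par (DirX (\<pi> v)))"
| "parallel_param S \<pi> (YVar v) = (if v \<in> S then 0 else par (Scale v) * par (DirY (\<pi> v)))"

definition parallel_prime :: "'v::countable set \<Rightarrow> 'v set \<Rightarrow> ('v \<Rightarrow> 'v) \<Rightarrow> ('v, 'k::field) edge_poly set" where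
  "parallel_prime W S \<pi> = {p \<in> carrier (poly_ring W). subst (parallel_param S \<pi>) p = 0}"

definition minor :: "'v \<Rightarrow> 'v \<Rightarrow> ('v, 'k::field) edge_poly" where
  "minor v w = x_var v * y_var w - x_var w * y_var v"

lemma parallel_prime_primeideal: "primeideal (parallel_prime W S \<pi>) (poly_ring W)"
  unfolding parallel_prime_def by (rule kernel_primeideal)

lemma subst_indet [simp]: "subst f (indet_poly z) = f z"
  by (simp add: indet_poly_eq_var)

lemma subst_par: "subst (\<lambda>k. h (from_nat k)) (par z) = h z"
  by (simp add: par_def)

text \<open>
  Deleting vertices and fusing classes are specialisations of the parameters: scalars become zero,
  directions become equal.
\<close>

lemma parallel_prime_mono:
  assumes "S \<subseteq> S'" and coarser: "\<And>v w. v \<in> W - S' \<Longrightarrow> w \<in> W - S' \<Longrightarrow> \<pi> v = \<pi> w \<Longrightarrow> \<rho> v = \<rho> w"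
  shows "parallel_prime W S \<pi> \<subseteq> (parallel_prime W S' \<rho> :: ('v::countable, 'k::field) edge_poly set)"
proof -
  define rep where "rep = (\<lambda>l. \<rho> (SOME v. v \<in> W - S' \<and> \<pi> v = l))"
  have rep: "rep (\<pi> v) = \<rho> v" if "v \<in> W - S'" for v
  proof -
    define w where "w = (SOME w. w \<in> W - S' \<and> \<pi> w = \<pi> v)"
    have "w \<in> W - S' \<and> \<pi> w = \<pi> v"
      unfolding w_def by (rule someI[of "\<lambda>w. w \<in> W - S' \<and> \<pi> w = \<pi> v" v]) (use that in blast)
    then have "\<rho> w = \<rho> v" using coarser[of w v] that by blast
    then show ?thesis by (simp add: rep_def w_def)
  qed
  define h :: "'v param \<Rightarrow> (nat, 'k) mpoly" where
    "h = (\<lambda>z. case z of Scale v \<Rightarrow> if v \<in> S' then 0 else par (Scale v)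
                      | DirX l \<Rightarrow> par (DirX (rep l)) | DirY l \<Rightarrow> par (DirY (rep l)))"
  show ?thesis
    unfolding parallel_prime_def
    by (rule kernel_mono[where h = "\<lambda>k. h (from_nat k)"])
       (use assms(1) in \<open>auto simp: subst_mult subst_par h_def rep\<close>)
qed

lemma parallel_prime_cong:
  assumes "\<And>v w. v \<in> W - S \<Longrightarrow> w \<in> W - S \<Longrightarrow> \<pi> v = \<pi> w \<longleftrightarrow> \<rho> v = \<rho> w"
  shows "parallel_prime W S \<pi> = parallel_prime W S \<rho>"
  by (intro equalityI parallel_prime_mono) (use assms in blast)+

lemma par_nonzero [simp]: "par z \<noteq> (0 :: (nat, 'k::field) mpoly)"
proof
  assume "par z = (0 :: (nat, 'k) mpoly)"
  then have "subst (\<lambda>_. 1 :: (nat, 'k) mpoly) (par z) = subst (\<lambda>_. 1) 0" by simp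
  then show False by (simp add: par_def)
qed

text \<open>
  Unique factorisation for products of two variables, obtained by setting \<open>a\<close> to \<open>0\<close> and all other
  parameters to \<open>1\<close>.
\<close>

lemma par_mult_eqD:
  assumes "par a * par b = (par c * par d :: (nat, 'k::field) mpoly)"
  shows "a = c \<or> a = d"
proof (rule ccontr)
  assume "\<not> (a = c \<or> a = d)"
  moreover have "subst (\<lambda>k. if from_nat k = a then 0 else 1) (par a * par b)
      = (subst (\<lambda>k. if from_nat k = a then 0 else 1) (par c * par d) :: (nat, 'k) mpoly)"
    using assms by simp
  ultimately show False
    by (auto simp: subst_mult subst_par[where h = "\<lambda>z. if z = a then 0 else 1"] split: if_splits)
qed

lemma x_var_in_parallel_prime_iff:
    "v \<in> W \<Longrightarrow> x_var v \<in> (parallel_prime W S \<pi> :: ('v::countable, 'k::field) edge_poly set) \<longleftrightarrow> v \<in> S"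
  by (auto simp: parallel_prime_def carrier_var)

lemma carrier_minor: "v \<in> W \<Longrightarrow> w \<in> W \<Longrightarrow> minor v w \<in> carrier (poly_ring W)"
  unfolding minor_def by (intro carrier_diff carrier_mult carrier_var)

lemma minor_in_parallel_prime_iff:
  assumes "v \<in> W" "w \<in> W"
  shows "minor v w \<in> (parallel_prime W S \<pi> :: ('v::countable, 'k::field) edge_poly set)
    \<longleftrightarrow> v \<in> S \<or> w \<in> S \<or> \<pi> v = \<pi> w"
proof (cases "v \<in> S \<or> w \<in> S")
  case False
  let ?b = "\<lambda>l. par (DirX l) :: (nat, 'k) mpoly" and ?c = "\<lambda>l. par (DirY l) :: (nat, 'k) mpoly"
  have "subst (parallel_param S \<pi>) (minor v w) = (par (Scale v) * par (Scale w)) *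
      (?b (\<pi> v) * ?c (\<pi> w) - ?b (\<pi> w) * ?c (\<pi> v))"
    using False by (simp add: minor_def subst_diff subst_mult algebra_simps)
  also have "\<dots> = 0 \<longleftrightarrow> \<pi> v = \<pi> w"
    using par_mult_eqD[of "DirX (\<pi> v)" "DirY (\<pi> w)" "DirX (\<pi> w)" "DirY (\<pi> v)", where ?'k = 'k]
    by auto
  finally show ?thesis
    using False assms by (simp add: parallel_prime_def carrier_minor)
qed (use assms in \<open>auto simp: parallel_prime_def carrier_minor minor_def subst_diff subst_mult
      carrier_diff carrier_mult carrier_var\<close>)


section \<open>Heights\<close>

lemma prime_chain_refl: "primeideal P R \<Longrightarrow> prime_chain R 0 P P"
  by (auto simp: prime_chain_def)

lemma prime_chain_single: "primeideal P R \<Longrightarrow> primeideal Q R \<Longrightarrow> P \<subset> Q \<Longrightarrow> prime_chain R 1 P Q"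
  unfolding prime_chain_def by (intro exI[of _ "\<lambda>i. if i = 0 then P else Q"]) auto

lemma prime_chain_trans:
  assumes "prime_chain R k P Q" "prime_chain R l Q Q'"
  shows "prime_chain R (k + l) P Q'"
proof -
  obtain C D where C: "\<And>i. i \<le> k \<Longrightarrow> primeideal (C i) R" "\<And>i. i < k \<Longrightarrow> C i \<subset> C (Suc i)" "C 0 = P" "C k = Q"
    and D: "\<And>i. i \<le> l \<Longrightarrow> primeideal (D i) R" "\<And>i. i < l \<Longrightarrow> D i \<subset> D (Suc i)" "D 0 = Q" "D l = Q'"
    using assms unfolding prime_chain_def by metis
  define E where "E = (\<lambda>i. if i \<le> k then C i else D (i - k))"
  have ED: "E (k + i) = D i" for i using C(4) D(3) by (auto simp: E_def)
  have "primeideal (E i) R" if "i \<le> k + l" for i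
    using that C(1) D(1)[of "i - k"] by (auto simp: E_def)
  moreover have "E i \<subset> E (Suc i)" if "i < k + l" for i
  proof (cases "i < k")
    case True then show ?thesis using C(2) by (simp add: E_def)
  next
    case False
    then have "i = k + (i - k)" "i - k < l" using that by auto
    then show ?thesis using D(2)[of "i - k"] ED[of "i - k"] ED[of "Suc (i - k)"] by simp
  qed
  moreover have "E 0 = P" "E (k + l) = Q'" using C(3) ED D(4) by (auto simp: E_def)
  ultimately show ?thesis unfolding prime_chain_def by blast
qed

lemma prime_height_alt: "prime_height R P = Sup {enat k | k. \<exists>P0. prime_chain R k P0 P}"
  by (simp add: prime_height_def prime_chain_def)

text \<open>
  One step for each deleted vertex \<open>v\<close>, as \<open>x_v\<close> enters the ideal.
\<close>

lemma delete_chain: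
  assumes "finite D" "D \<inter> S = {}" "D \<subseteq> W"
  shows "prime_chain (poly_ring W) (card D) (parallel_prime W S \<pi>)
    (parallel_prime W (S \<union> D) \<pi> :: ('v::countable, 'k::field) edge_poly set)"
  using assms
proof (induction D rule: finite_induct)
  case empty
  then show ?case by (simp add: prime_chain_refl parallel_prime_primeideal)
next
  case (insert v D)
  have "parallel_prime W (S \<union> D) \<pi> \<subseteq> (parallel_prime W (S \<union> insert v D) \<pi> :: ('v, 'k) edge_poly set)"
    by (rule parallel_prime_mono) auto
  moreover have "x_var v \<notin> parallel_prime W (S \<union> D) \<pi>"
    "x_var v \<in> (parallel_prime W (S \<union> insert v D) \<pi> :: ('v, 'k) edge_poly set)"
    using insert by (auto simp: x_var_in_parallel_prime_iff)
  ultimately have "prime_chain (poly_ring W) 1 (parallel_prime W (S \<union> D) \<pi>)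
      (parallel_prime W (S \<union> insert v D) \<pi> :: ('v, 'k) edge_poly set)"
    by (intro prime_chain_single parallel_prime_primeideal) blast
  then show ?case using prime_chain_trans insert by fastforce
qed

lemma card_image_coarser_le:
  assumes "finite T" "\<And>v w. v \<in> T \<Longrightarrow> w \<in> T \<Longrightarrow> \<pi> v = \<pi> w \<Longrightarrow> \<rho> v = \<rho> w"
  shows "card (\<rho> ` T) \<le> card (\<pi> ` T)"
proof -
  obtain U where U: "U \<subseteq> T" "inj_on \<rho> U" "\<rho> ` T = \<rho> ` U"
    using subset_image_inj[of "\<rho> ` T" \<rho> T] by auto
  have "inj_on \<pi> U" using U assms(2) unfolding inj_on_def by blast
  then have "card (\<rho> ` T) = card (\<pi> ` U)" using U by (simp add: card_image)
  also have "\<dots> \<le> card (\<pi> ` T)" using U assms(1) by (intro card_mono) auto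
  finally show ?thesis .
qed

text \<open>
  One step for each fusion of two classes, as the \<open>2 \<times> 2\<close> minor of vectors from both classes enters the
  ideal.
\<close>

lemma merge_chain:
  fixes \<pi> \<rho> :: "'v::countable \<Rightarrow> 'v"
  assumes "finite W" and "\<And>v w. v \<in> W - S \<Longrightarrow> w \<in> W - S \<Longrightarrow> \<pi> v = \<pi> w \<Longrightarrow> \<rho> v = \<rho> w"
  shows "prime_chain (poly_ring W) (card (\<pi> ` (W - S)) - card (\<rho> ` (W - S)))
    (parallel_prime W S \<pi>) (parallel_prime W S \<rho> :: ('v, 'k::field) edge_poly set)"
  using assms(2)
proof (induction "card (\<pi> ` (W - S))" arbitrary: \<pi>)
  case 0
  then have "W - S = {}" using \<open>finite W\<close> by (metis card_0_eq finite_Diff finite_imageI image_is_empty)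
  then have "parallel_prime W S \<pi> = (parallel_prime W S \<rho> :: ('v, 'k) edge_poly set)"
    by (intro parallel_prime_cong) auto
  then show ?case unfolding \<open>W - S = {}\<close> by (simp add: prime_chain_refl parallel_prime_primeideal)
next
  case (Suc n)
  let ?T = "W - S"
  show ?case
  proof (cases "\<exists>v\<in>?T. \<exists>w\<in>?T. \<pi> v \<noteq> \<pi> w \<and> \<rho> v = \<rho> w")
    case True
    then obtain v w where vw: "v \<in> ?T" "w \<in> ?T" "\<pi> v \<noteq> \<pi> w" "\<rho> v = \<rho> w" by blast
    define \<sigma> where "\<sigma> = (\<lambda>u. if \<pi> u = \<pi> v then \<pi> w else \<pi> u)"
    have "\<sigma> ` ?T = \<pi> ` ?T - {\<pi> v}"
      using vw unfolding \<sigma>_def by (auto simp: image_iff)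
    moreover have "\<pi> v \<in> \<pi> ` ?T" using vw by blast
    ultimately have card: "card (\<pi> ` ?T) = Suc (card (\<sigma> ` ?T))"
      using \<open>finite W\<close> card_Suc_Diff1[of "\<pi> ` ?T" "\<pi> v"] by simp
    have coarser: "\<rho> a = \<rho> b" if "a \<in> ?T" "b \<in> ?T" "\<sigma> a = \<sigma> b" for a b
    proof -
      have *: "\<rho> c = \<rho> d" if "c \<in> ?T" "d \<in> ?T" "\<pi> c = \<pi> d" for c d
        using Suc.prems that by blast
      show ?thesis
        using that vw *[of a b] *[of a v] *[of b v] *[of a w] *[of b w]
        by (auto simp: \<sigma>_def split: if_splits)
    qed
    have "parallel_prime W S \<pi> \<subseteq> (parallel_prime W S \<sigma> :: ('v, 'k) edge_poly set)"
      by (rule parallel_prime_mono) (auto simp: \<sigma>_def)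
    moreover have "minor v w \<notin> parallel_prime W S \<pi>"
      "minor v w \<in> (parallel_prime W S \<sigma> :: ('v, 'k) edge_poly set)"
      using vw by (auto simp: minor_in_parallel_prime_iff \<sigma>_def)
    ultimately have first: "prime_chain (poly_ring W) 1 (parallel_prime W S \<pi>)
        (parallel_prime W S \<sigma> :: ('v, 'k) edge_poly set)"
      by (intro prime_chain_single parallel_prime_primeideal) blast
    have rest: "prime_chain (poly_ring W) (card (\<sigma> ` ?T) - card (\<rho> ` ?T))
        (parallel_prime W S \<sigma>) (parallel_prime W S \<rho> :: ('v, 'k) edge_poly set)"
    proof (rule Suc.hyps(1))
      show "n = card (\<sigma> ` ?T)" using Suc.hyps(2) card by simp
    qed (fact coarser)
    have "card (\<rho> ` ?T) \<le> card (\<sigma> ` ?T)"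
    proof (rule card_image_coarser_le)
      show "finite ?T" using \<open>finite W\<close> by simp
    qed (fact coarser)
    then have "card (\<pi> ` ?T) - card (\<rho> ` ?T) = 1 + (card (\<sigma> ` ?T) - card (\<rho> ` ?T))"
      using card by simp
    then show ?thesis using prime_chain_trans[OF first rest] by simp
  next
    case False
    then have eq: "\<pi> v = \<pi> w \<longleftrightarrow> \<rho> v = \<rho> w" if "v \<in> ?T" "w \<in> ?T" for v w
      using that Suc.prems by blast
    have "parallel_prime W S \<pi> = (parallel_prime W S \<rho> :: ('v, 'k) edge_poly set)"
      by (rule parallel_prime_cong) (rule eq)
    moreover have "card (\<pi> ` ?T) \<le> card (\<rho> ` ?T)"
    proof (rule card_image_coarser_le)
      show "finite ?T" using \<open>finite W\<close> by simp
    qed (simp add: eq)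
    ultimately show ?thesis by (simp add: prime_chain_refl parallel_prime_primeideal)
  qed
qed

text \<open>
  The vector of the last remaining vertex is unconstrained; its two coordinates are set to zero one
  after the other.
\<close>

lemma top_chain:
  fixes W :: "'v::countable set"
  assumes "t \<in> W"
  shows "\<exists>M. prime_chain (poly_ring W) 2 (parallel_prime W (W - {t}) \<pi>) (M :: ('v, 'k::field) edge_poly set)"
proof -
  define f :: "'v indet \<Rightarrow> (nat, 'k) mpoly" where "f = (\<lambda>i. if i = YVar t then par (Scale t) else 0)"
  let ?K = "\<lambda>f :: 'v indet \<Rightarrow> (nat, 'k) mpoly. {p \<in> carrier (poly_ring W). subst f p = 0}"
  define h :: "'v param \<Rightarrow> (nat, 'k) mpoly" where
    "h = (\<lambda>z. case z of Scale v \<Rightarrow> par (Scale v) | DirX l \<Rightarrow> 0 | DirY l \<Rightarrow> 1)"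
  have "parallel_prime W (W - {t}) \<pi> \<subseteq> ?K f"
    unfolding parallel_prime_def
    by (rule kernel_mono[where h = "\<lambda>k. h (from_nat k)"])
       (auto simp: subst_mult subst_par h_def f_def if_distrib[of "subst _"] split: if_splits)
  moreover have "x_var t \<in> ?K f" using assms by (simp add: carrier_var f_def)
  moreover have "x_var t \<notin> parallel_prime W (W - {t}) \<pi>"
    using assms by (simp add: x_var_in_parallel_prime_iff)
  ultimately have 1: "prime_chain (poly_ring W) 1 (parallel_prime W (W - {t}) \<pi>) (?K f)"
    by (intro prime_chain_single parallel_prime_primeideal kernel_primeideal) blast
  have "?K f \<subseteq> ?K (\<lambda>_. 0)"
    by (rule kernel_mono[where h = "\<lambda>_. 0"]) (auto simp: f_def par_def)
  moreover have "y_var t \<in> ?K (\<lambda>_. 0)" "y_var t \<notin> ?K f"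
    using assms by (simp_all add: carrier_var f_def)
  ultimately have 2: "prime_chain (poly_ring W) 1 (?K f) (?K (\<lambda>_. 0))"
    by (intro prime_chain_single kernel_primeideal) blast
  show ?thesis using prime_chain_trans[OF 1 2] by (auto simp: numeral_2_eq_2)
qed

text \<open>
  Every chain below the prime extends upwards by fusing all classes into one, deleting all vertices
  but one, and killing the two coordinates of the last one.  The total length is at most
  \<open>2 * card W\<close>.  A chain of the asserted length starts at the prime of unrelated directions, which is
  the zero ideal.
\<close>

theorem prime_height_parallel_prime:
  fixes \<pi> :: "'v::countable \<Rightarrow> 'v"
  assumes "finite W" "S \<subset> W"
  shows "prime_height (poly_ring W) (parallel_prime W S \<pi> :: ('v, 'k::field) edge_poly set)
    = enat (card W + card S - card (\<pi> ` (W - S)))"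
proof -
  let ?R = "poly_ring W :: ('v, 'k) edge_poly ring"
  let ?P = "parallel_prime W :: 'v set \<Rightarrow> ('v \<Rightarrow> 'v) \<Rightarrow> ('v, 'k) edge_poly set"
  let ?c = "card (\<pi> ` (W - S))"
  obtain t where t: "t \<in> W" "t \<notin> S" using assms by blast
  have fin: "finite S" using assms finite_subset by blast
  have cS: "card S \<le> card W" "card (W - S) = card W - card S"
    using assms fin by (auto intro: card_mono simp: card_Diff_subset)
  have c: "?c \<le> card W - card S" using card_image_le[of "W - S" \<pi>] assms(1) cS by simp
  have "?c \<noteq> 0" using t assms(1) by auto
  \<comment> \<open>Before their deletion the vertices of \<open>S\<close> are put into the class of a remaining vertex \<open>t\<close>, so that each costs one fusion and one deletion.\<close>
  define \<pi>' where "\<pi>' = (\<lambda>v. if v \<in> S then \<pi> t else \<pi> v)"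
  have img: "\<pi>' ` W = \<pi> ` (W - S)" using t assms(2) by (auto simp: \<pi>'_def)
  have "prime_chain ?R (card W - ?c) (?P {} id) (?P {} \<pi>')"
    using merge_chain[OF assms(1), of "{}" id \<pi>'] img by simp
  moreover have "prime_chain ?R (card S) (?P {} \<pi>') (?P S \<pi>')"
    using delete_chain[OF fin, of "{}" W \<pi>'] assms(2) by auto
  moreover have "?P S \<pi>' = ?P S \<pi>" by (rule parallel_prime_cong) (auto simp: \<pi>'_def)
  ultimately have "prime_chain ?R (card W - ?c + card S) (?P {} id) (?P S \<pi>)"
    using prime_chain_trans by metis
  moreover have "card W - ?c + card S = card W + card S - ?c" using c by simp
  ultimately have lower: "prime_chain ?R (card W + card S - ?c) (?P {} id) (?P S \<pi>)" by simp
  have upper: "k \<le> card W + card S - ?c" if "prime_chain ?R k P0 (?P S \<pi>)" for k P0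
  proof -
    have "prime_chain ?R (?c - 1) (?P S \<pi>) (?P S (\<lambda>_. t))"
    proof -
      have "(\<lambda>_. t) ` (W - S) = {t}" using t by auto
      then show ?thesis using merge_chain[OF assms(1), of S \<pi> "\<lambda>_. t"] by simp
    qed
    moreover have "prime_chain ?R (card (W - {t} - S)) (?P S (\<lambda>_. t)) (?P (S \<union> (W - {t} - S)) (\<lambda>_. t))"
      by (rule delete_chain) (use assms in auto)
    moreover have "S \<union> (W - {t} - S) = W - {t}" using t assms(2) by auto
    moreover obtain M where "prime_chain ?R 2 (?P (W - {t}) (\<lambda>_. t)) M" using top_chain[OF t(1)] by blast
    ultimately have "prime_chain ?R (k + (?c - 1 + (card (W - {t} - S) + 2))) P0 M"
      using that prime_chain_trans by metis
    then have "k + (?c - 1 + (card (W - {t} - S) + 2)) \<le> 2 * card W"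
      by (rule prime_chain_length_le[OF assms(1)])
    moreover have "W - {t} - S = (W - S) - {t}" by auto
    then have "card (W - {t} - S) = card W - card S - 1" using t cS assms(1) by simp
    ultimately show ?thesis using c \<open>?c \<noteq> 0\<close> cS(1) by linarith
  qed
  show ?thesis
    unfolding prime_height_alt
  proof (rule antisym)
    show "Sup {enat k |k. \<exists>P0. prime_chain ?R k P0 (?P S \<pi>)} \<le> enat (card W + card S - ?c)"
      by (rule Sup_least) (use upper in auto)
    show "enat (card W + card S - ?c) \<le> Sup {enat k |k. \<exists>P0. prime_chain ?R k P0 (?P S \<pi>)}"
      by (rule Sup_upper) (use lower in blast)
  qed
qed


section \<open>Primes containing the parallelism relations\<close>

lemma congruent_mult:
  assumes Q: "primeideal Q (poly_ring W)" and "a - a' \<in> Q" "b - b' \<in> Q"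
    and "a \<in> carrier (poly_ring W)" "b' \<in> carrier (poly_ring W)"
  shows "a * b - a' * b' \<in> Q"
proof -
  have "a * (b - b') + b' * (a - a') \<in> Q"
    using assms by (intro prime_add[OF Q] prime_mult[OF Q])
  then show ?thesis by (simp add: algebra_simps)
qed

lemma congruent_mono_val:
  assumes Q: "primeideal Q (poly_ring W)"
    and fg: "\<And>i. i \<in> Poly_Mapping.keys m \<Longrightarrow>
      f i \<in> carrier (poly_ring W) \<and> g i \<in> carrier (poly_ring W) \<and> f i - g i \<in> Q"
  shows "mono_val f m - mono_val g m \<in> Q"
proof -
  have pow: "a ^ n - b ^ n \<in> Q" if "a \<in> carrier (poly_ring W)" "b \<in> carrier (poly_ring W)" "a - b \<in> Q" for a b n
  proof (induction n)
    case 0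
    then show ?case using prime_0[OF Q] by simp
  next
    case (Suc n)
    then show ?case using that by (simp add: congruent_mult[OF Q] carrier_power)
  qed
  have "(\<Prod>i\<in>I. f i ^ Poly_Mapping.lookup m i) - (\<Prod>i\<in>I. g i ^ Poly_Mapping.lookup m i) \<in> Q"
    if "finite I" "I \<subseteq> Poly_Mapping.keys m" for I
    using that
  proof (induction I rule: finite_induct)
    case empty
    then show ?case using prime_0[OF Q] by simp
  next
    case (insert i I)
    have "f j ^ Poly_Mapping.lookup m j \<in> carrier (poly_ring W)"
      "g j ^ Poly_Mapping.lookup m j \<in> carrier (poly_ring W)"
      "f j ^ Poly_Mapping.lookup m j - g j ^ Poly_Mapping.lookup m j \<in> Q" if "j \<in> insert i I" for j
      using fg[of j] insert.prems that pow by (auto intro: carrier_power)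
    then show ?case
      using insert by (simp add: congruent_mult[OF Q] carrier_prod)
  qed
  then show ?thesis by (simp add: mono_val_def)
qed

definition total_degree :: "('i \<Rightarrow>\<^sub>0 nat) \<Rightarrow> nat" where
  "total_degree m = (\<Sum>i \<in> Poly_Mapping.keys m. Poly_Mapping.lookup m i)"

lemma total_degree_superset:
  "finite A \<Longrightarrow> Poly_Mapping.keys m \<subseteq> A \<Longrightarrow> total_degree m = (\<Sum>i \<in> A. Poly_Mapping.lookup m i)"
  unfolding total_degree_def by (intro sum.mono_neutral_left) (auto simp: in_keys_iff)

lemma total_degree_add: "total_degree (m + m') = total_degree m + total_degree m'"
proof -
  let ?A = "Poly_Mapping.keys m \<union> Poly_Mapping.keys m'"
  have "Poly_Mapping.keys (m + m') \<subseteq> ?A" by (rule Poly_Mapping.keys_add)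
  then show ?thesis
    by (simp add: total_degree_superset[of ?A] lookup_add sum.distrib)
qed

lemma mono_val_scale: "mono_val (\<lambda>i. c * f i) m = c ^ total_degree m * mono_val f m"
  by (simp add: mono_val_def total_degree_def power_mult_distrib prod.distrib power_sum)

definition homogeneous :: "nat \<Rightarrow> ('i, 'k::comm_ring_1) mpoly \<Rightarrow> bool" where
  "homogeneous d p \<longleftrightarrow> (\<forall>m \<in> Poly_Mapping.keys p. total_degree m = d)"

lemma homogeneous_mult: "homogeneous d p \<Longrightarrow> homogeneous e q \<Longrightarrow> homogeneous (d + e) (p * q)"
  unfolding homogeneous_def using keys_mult[of p q] by (fastforce simp: total_degree_add)

lemma homogeneous_0: "homogeneous d 0"
  by (simp add: homogeneous_def)

lemma homogeneous_1: "homogeneous 0 1"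
  by (simp add: homogeneous_def total_degree_def)

lemma homogeneous_mono_val:
  assumes "\<And>i. homogeneous d (f i)"
  shows "homogeneous (d * total_degree m) (mono_val f m)"
proof -
  have pow: "homogeneous (d * n) (f i ^ n)" for i n
    by (induction n) (simp_all add: homogeneous_1 homogeneous_mult assms)
  have "homogeneous (d * (\<Sum>i\<in>I. Poly_Mapping.lookup m i)) (\<Prod>i\<in>I. f i ^ Poly_Mapping.lookup m i)"
    if "finite I" for I
    using that by (induction I rule: finite_induct) (simp_all add: homogeneous_1 homogeneous_mult pow distrib_left)
  then show ?thesis by (simp add: mono_val_def total_degree_def)
qed

lemma homogeneous_parallel: "homogeneous 2 (parallel_param S \<pi> i)"
proof -
  have "homogeneous 1 (par z)" for z :: "'v::countable param"
    by (simp add: homogeneous_def par_def var_def total_degree_def)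
  from homogeneous_mult[OF this this] show ?thesis
    by (cases i) (auto simp: homogeneous_0 numeral_2_eq_2)
qed

text \<open>
  A linear map that weights the value of every monomial by a factor depending on its degree acts on
  homogeneous polynomials as a multiple of a substitution.
\<close>

lemma lin_ext_homogeneous:
  assumes "homogeneous d p"
  shows "lin_ext (\<lambda>e. h (total_degree e) * mono_val f e) p = h d * subst f p"
  unfolding lin_ext_def subst_def sum_distrib_left
  by (rule sum.cong) (use assms in \<open>auto simp: homogeneous_def ac_simps\<close>)

text \<open>
  Modulo \<open>Q\<close>, every class \<open>l\<close> contains a representative one of whose coordinates, \<open>\<alpha> l\<close>, is nonzero.
  Over the fraction field the vector of \<open>v\<close> is then the direction of the representative of \<open>l\<close>, scaled
  by the corresponding coordinate of \<open>v\<close> divided by \<open>\<alpha> l\<close>.  So the generic point of \<open>Q\<close> is a value of the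
  parametrisation, and polynomials vanishing on the parametrisation lie in \<open>Q\<close>.

  To stay in the polynomial ring, denominators are cleared with the product \<open>A\<close> of all \<open>\<alpha> l\<close>.  The
  substitution \<open>f\<close> of polynomials for the parameters then recovers \<open>A * x_v\<close> and \<open>A * y_v\<close> modulo \<open>Q\<close>, so a
  monomial of degree \<open>d\<close> is recovered up to the factor \<open>A ^ d\<close>.  The weights \<open>A ^ (D - d)\<close> in \<open>\<Lambda>\<close>
  equalise these factors; the division by \<open>2\<close> accounts for the parametrisation being quadratic.
\<close>

theorem parallel_prime_subset_prime:
  fixes Q :: "('v::countable, 'k::field) edge_poly set"
  assumes "finite W" "S \<subseteq> W" and Q: "primeideal Q (poly_ring W)"
    and killed: "\<And>v. v \<in> S \<Longrightarrow> x_var v \<in> Q \<and> y_var v \<in> Q"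
    and nonzero: "\<And>v. v \<in> W - S \<Longrightarrow> \<not> (x_var v \<in> Q \<and> y_var v \<in> Q)"
    and minors: "\<And>v w. v \<in> W - S \<Longrightarrow> w \<in> W - S \<Longrightarrow> \<pi> v = \<pi> w \<Longrightarrow> minor v w \<in> Q"
  shows "parallel_prime W S \<pi> \<subseteq> Q"
proof
  fix p :: "('v, 'k) edge_poly"
  assume "p \<in> parallel_prime W S \<pi>"
  then have p: "p \<in> carrier (poly_ring W)" "subst (parallel_param S \<pi>) p = 0"
    by (auto simp: parallel_prime_def)
  let ?T = "W - S"
  define L where "L = \<pi> ` ?T"
  define rep where "rep = (\<lambda>l. SOME v. v \<in> ?T \<and> \<pi> v = l)"
  have rep: "rep l \<in> ?T" "\<pi> (rep l) = l" if "l \<in> L" for l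
    using that someI_ex[of "\<lambda>v. v \<in> ?T \<and> \<pi> v = l"] unfolding L_def rep_def by auto
  define coord :: "'v \<Rightarrow> 'v \<Rightarrow> ('v, 'k) edge_poly"
    where "coord = (\<lambda>l v. if x_var (rep l) \<in> Q then y_var v else x_var v)"
  define \<alpha> where "\<alpha> = (\<lambda>l. coord l (rep l))"
  have coord: "coord l v \<in> carrier (poly_ring W)" if "v \<in> W" for l v
    using that by (simp add: coord_def carrier_var)
  have \<alpha>: "\<alpha> l \<in> carrier (poly_ring W)" "\<alpha> l \<notin> Q" if "l \<in> L" for l
    using coord rep[OF that] nonzero[of "rep l"] unfolding \<alpha>_def by (auto simp: coord_def)
  define A where "A = prod \<alpha> L"
  define B where "B = (\<lambda>l. prod \<alpha> (L - {l}))"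
  have A: "A \<in> carrier (poly_ring W)" "A \<notin> Q"
    unfolding A_def by (rule carrier_prod, erule \<alpha>) (rule prime_not_in_prod[OF Q], (erule \<alpha>)+)
  have B: "B l \<in> carrier (poly_ring W)" for l
    unfolding B_def using \<alpha> by (auto intro: carrier_prod)
  have AB: "A = \<alpha> l * B l" if "l \<in> L" for l
    unfolding A_def B_def using that \<open>finite W\<close> by (intro prod.remove) (auto simp: L_def)
  define h :: "'v param \<Rightarrow> ('v, 'k) edge_poly" where
    "h = (\<lambda>z. case z of Scale v \<Rightarrow> B (\<pi> v) * coord (\<pi> v) v | DirX l \<Rightarrow> x_var (rep l) | DirY l \<Rightarrow> y_var (rep l))"
  define f where "f = (\<lambda>k :: nat. h (from_nat k))"
  have f_par: "subst f (par z) = h z" for z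
    unfolding f_def by (rule subst_par)
  define \<psi> where "\<psi> = (\<lambda>i. subst f (parallel_param S \<pi> i))"
  have \<psi>: "\<psi> i \<in> carrier (poly_ring W) \<and> A * var i \<in> carrier (poly_ring W) \<and> \<psi> i - A * var i \<in> Q"
    if i: "i \<in> XVar ` W \<union> YVar ` W" for i
  proof -
    obtain v where v: "v \<in> W" "i = XVar v \<or> i = YVar v" using i by blast
    have var: "var i \<in> carrier (poly_ring W)" using i by (simp add: carrier_poly_ring)
    show ?thesis
    proof (cases "v \<in> S")
      case True
      then have "\<psi> i = 0" "var i \<in> Q"
        using v killed[OF True] by (auto simp: \<psi>_def indet_poly_eq_var)
      then show ?thesis
        using prime_uminus[OF Q prime_mult[OF Q A(1)]] carrier_mult[OF A(1) var] by simp
    next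
      case False
      let ?l = "\<pi> v" and ?c = "rep (\<pi> v)"
      have l: "?l \<in> L" using v False by (auto simp: L_def)
      have c: "?c \<in> ?T" "\<pi> ?c = ?l" using rep[OF l] by auto
      have Minors: "minor v ?c \<in> Q" "minor ?c v \<in> Q" using minors[of v ?c] minors[of ?c v] v False c by auto
      have zero: "0 \<in> Q" by (rule prime_0[OF Q])
      have "\<exists>q\<in>Q. \<psi> i - A * var i = B ?l * q"
        using v(2)
      proof
        assume i: "i = XVar v"
        have eq: "\<psi> i - A * var i = B ?l * (coord ?l v * x_var ?c - \<alpha> ?l * x_var v)"
          using False by (simp add: i \<psi>_def subst_mult f_par h_def AB[OF l] indet_poly_eq_var algebra_simps)
        have "coord ?l v * x_var ?c - \<alpha> ?l * x_var v = (if x_var ?c \<in> Q then minor ?c v else 0)"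
          by (simp add: coord_def \<alpha>_def minor_def)
        then have "coord ?l v * x_var ?c - \<alpha> ?l * x_var v \<in> Q" using zero Minors by simp
        with eq show ?thesis by blast
      next
        assume i: "i = YVar v"
        have eq: "\<psi> i - A * var i = B ?l * (coord ?l v * y_var ?c - \<alpha> ?l * y_var v)"
          using False by (simp add: i \<psi>_def subst_mult f_par h_def AB[OF l] indet_poly_eq_var algebra_simps)
        have "coord ?l v * y_var ?c - \<alpha> ?l * y_var v = (if x_var ?c \<in> Q then 0 else minor v ?c)"
          by (simp add: coord_def \<alpha>_def minor_def)
        then have "coord ?l v * y_var ?c - \<alpha> ?l * y_var v \<in> Q" using zero Minors by simp
        with eq show ?thesis by blast
      qed
      moreover have "\<psi> i \<in> carrier (poly_ring W)"
        using v c False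
        by (auto simp: \<psi>_def subst_mult f_par h_def intro!: carrier_mult B coord carrier_var)
      ultimately show ?thesis using carrier_mult[OF A(1) var] prime_mult[OF Q B] by auto
    qed
  qed
  obtain D where D: "\<And>m. m \<in> Poly_Mapping.keys p \<Longrightarrow> total_degree m \<le> D"
    using finite_nat_set_iff_bounded_le[of "total_degree ` Poly_Mapping.keys p"] by auto
  define \<Lambda> where "\<Lambda> = lin_ext (\<lambda>e. A ^ (D - total_degree e div 2) * mono_val f e)"
  have "\<Lambda> (subst (parallel_param S \<pi>) p) - A ^ D * p \<in> Q"
  proof (induction p rule: poly_mapping_induct_add)
    case zero
    then show ?case using prime_0[OF Q] by (simp add: \<Lambda>_def)
  next
    case (single m c)
    let ?d = "total_degree m"
    have keys: "Poly_Mapping.keys m \<subseteq> XVar ` W \<union> YVar ` W"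
      using single p(1) by (auto simp: carrier_poly_ring vars_def)
    have "\<Lambda> (mono_val (parallel_param S \<pi>) m) = A ^ (D - ?d) * mono_val \<psi> m"
      unfolding \<Lambda>_def \<psi>_def
      using lin_ext_homogeneous[OF homogeneous_mono_val[OF homogeneous_parallel],
          where h = "\<lambda>e. A ^ (D - e div 2)"]
      by (simp add: subst_mono_val)
    then have "\<Lambda> (subst (parallel_param S \<pi>) (Poly_Mapping.single m c)) = const c * (A ^ (D - ?d) * mono_val \<psi> m)"
      by (simp add: \<Lambda>_def subst_single lin_ext_const_mult)
    moreover have "A ^ D * Poly_Mapping.single m c = const c * (A ^ (D - ?d) * mono_val (\<lambda>i. A * var i) m)"
    proof -
      have split: "A ^ D = A ^ (D - ?d) * A ^ ?d" "Poly_Mapping.single m c = const c * Poly_Mapping.single m 1"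
        using D[OF single] by (simp_all add: power_add [symmetric] const_mult_single)
      show ?thesis unfolding mono_val_scale mono_val_var split by (simp only: mult_ac)
    qed
    ultimately have "\<Lambda> (subst (parallel_param S \<pi>) (Poly_Mapping.single m c)) - A ^ D * Poly_Mapping.single m c
        = const c * (A ^ (D - ?d) * (mono_val \<psi> m - mono_val (\<lambda>i. A * var i) m))"
      by (simp add: algebra_simps)
    moreover have "mono_val \<psi> m - mono_val (\<lambda>i. A * var i) m \<in> Q"
      by (rule congruent_mono_val[OF Q]) (use \<psi> keys in blast)
    ultimately show ?case
      using A(1) by (auto intro!: prime_mult[OF Q] carrier_power)
  next
    case (add q r)
    then show ?case
      using prime_add[OF Q] by (fastforce simp: \<Lambda>_def subst_add lin_ext_add algebra_simps)
  qed
  then have "- (A ^ D * p) \<in> Q" using p(2) by (simp add: \<Lambda>_def)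
  then have "A ^ D * p \<in> Q" using prime_uminus[OF Q] by fastforce
  then show "p \<in> Q"
    using prime_prime[OF Q carrier_power[OF A(1)] p(1)] prime_not_in_power[OF Q A] by blast
qed


section \<open>Minimal primes of binomial edge ideals\<close>

definition remaining_edges :: "'v set \<times> 'v set set \<Rightarrow> 'v set \<Rightarrow> ('v \<times> 'v) set" where
  "remaining_edges G S = {(v, w). v \<in> fst G - S \<and> w \<in> fst G - S \<and> {v, w} \<in> snd G}"

definition component :: "'v set \<times> 'v set set \<Rightarrow> 'v set \<Rightarrow> 'v \<Rightarrow> 'v" where
  "component G S v = (SOME w. (v, w) \<in> (remaining_edges G S)\<^sup>*)"

definition num_components :: "'v set \<times> 'v set set \<Rightarrow> 'v set \<Rightarrow> nat" where
  "num_components G S = card (component G S ` (fst G - S))"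

definition component_prime :: "'v::countable set \<times> 'v set set \<Rightarrow> 'v set \<Rightarrow> ('v, 'k::field) edge_poly set" where
  "component_prime G S = parallel_prime (fst G) S (component G S)"

definition cut_set :: "'v set \<times> 'v set set \<Rightarrow> 'v set \<Rightarrow> bool" where
  "cut_set G S \<longleftrightarrow> S \<subseteq> fst G \<and> (\<forall>s\<in>S. \<exists>v\<in>fst G - S. \<exists>w\<in>fst G - S.
     {s, v} \<in> snd G \<and> {s, w} \<in> snd G \<and> component G S v \<noteq> component G S w)"

lemma remaining_edges_sym: "(v, w) \<in> (remaining_edges G S)\<^sup>* \<Longrightarrow> (w, v) \<in> (remaining_edges G S)\<^sup>*"
proof -
  have "sym (remaining_edges G S)"
    by (auto simp: sym_def remaining_edges_def insert_commute)
  then show "(v, w) \<in> (remaining_edges G S)\<^sup>* \<Longrightarrow> (w, v) \<in> (remaining_edges G S)\<^sup>*"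
    by (meson sym_rtrancl symD)
qed

text \<open>
  Connected vertices reach the same vertices, so the choice operator selects the same one for both.
\<close>

lemma component_eq_iff: "component G S v = component G S w \<longleftrightarrow> (v, w) \<in> (remaining_edges G S)\<^sup>*"
proof
  have rep: "(u, component G S u) \<in> (remaining_edges G S)\<^sup>*" for u
    unfolding component_def by (rule someI[of _ u]) simp
  show "component G S v = component G S w \<Longrightarrow> (v, w) \<in> (remaining_edges G S)\<^sup>*"
    using rep[of v] remaining_edges_sym[OF rep[of w]] by (metis rtrancl_trans)
  assume vw: "(v, w) \<in> (remaining_edges G S)\<^sup>*"
  then have "(v, u) \<in> (remaining_edges G S)\<^sup>* \<longleftrightarrow> (w, u) \<in> (remaining_edges G S)\<^sup>*" for u
    using remaining_edges_sym[OF vw] by (meson rtrancl_trans)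
  then show "component G S v = component G S w" by (simp add: component_def)
qed

lemma component_edge:
  "v \<in> fst G - S \<Longrightarrow> w \<in> fst G - S \<Longrightarrow> {v, w} \<in> snd G \<Longrightarrow> component G S v = component G S w"
  by (auto simp: component_eq_iff remaining_edges_def)

lemma component_prime_primeideal: "primeideal (component_prime G S) (graph_ring G)"
  unfolding component_prime_def by (rule parallel_prime_primeideal)

lemma edge_in_vertices: "finite_simple_graph G \<Longrightarrow> {a, b} \<in> snd G \<Longrightarrow> a \<in> fst G \<and> b \<in> fst G \<and> a \<noteq> b"
  unfolding finite_simple_graph_def by force

lemma binomial_edge_ideal_subset_iff:
  fixes Q :: "('v, 'k::field) edge_poly set"
  assumes G: "finite_simple_graph G" and Q: "primeideal Q (graph_ring G)"
  shows "binomial_edge_ideal G \<subseteq> Q \<longleftrightarrow> (\<forall>a b. {a, b} \<in> snd G \<longrightarrow> minor a b \<in> Q)"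
proof -
  let ?R = "graph_ring G :: ('v, 'k) edge_poly ring"
  let ?E = "{x_var a * y_var b - x_var b * y_var a | a b. {a, b} \<in> snd G} :: ('v, 'k) edge_poly set"
  interpret cring ?R by (rule cring_poly_ring)
  have "ideal Q ?R" using Q by (simp add: primeideal_def)
  then have "binomial_edge_ideal G \<subseteq> Q \<longleftrightarrow> ?E \<subseteq> Q"
    unfolding binomial_edge_ideal_def
    using genideal_minimal[of Q ?E] genideal_self[OF edge_generators_subset_carrier[OF G]] by blast
  also have "\<dots> \<longleftrightarrow> (\<forall>a b. {a, b} \<in> snd G \<longrightarrow> minor a b \<in> Q)"
    by (auto simp: minor_def)
  finally show ?thesis .
qed

lemma binomial_edge_ideal_subset_component_prime:
  assumes G: "finite_simple_graph G"
  shows "binomial_edge_ideal G \<subseteq> (component_prime G S :: ('v::countable, 'k::field) edge_poly set)"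
proof -
  have "minor a b \<in> (component_prime G S :: ('v, 'k) edge_poly set)" if "{a, b} \<in> snd G" for a b
  proof -
    have "a \<in> fst G" "b \<in> fst G" using edge_in_vertices[OF G that] by auto
    then show ?thesis
      using component_edge[of a G S b] that
      by (auto simp: component_prime_def minor_in_parallel_prime_iff)
  qed
  then show ?thesis using binomial_edge_ideal_subset_iff[OF G component_prime_primeideal] by blast
qed

definition killed_vertices :: "'v set \<times> 'v set set \<Rightarrow> ('v, 'k::field) edge_poly set \<Rightarrow> 'v set" where
  "killed_vertices G Q = {v \<in> fst G. x_var v \<in> Q \<and> y_var v \<in> Q}"

text \<open>
  Parallelism propagates along a path of vertices outside the killed set: for a nonzero vector at \<open>u\<close>,
  the minor of \<open>v\<close> and \<open>w\<close> times either coordinate at \<open>u\<close> is a combination of the minors of \<open>v, u\<close> and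
  of \<open>u, w\<close>.
\<close>

lemma component_prime_killed_vertices_subset:
  fixes Q :: "('v::countable, 'k::field) edge_poly set"
  assumes G: "finite_simple_graph G" and Q: "primeideal Q (graph_ring G)" "binomial_edge_ideal G \<subseteq> Q"
  shows "component_prime G (killed_vertices G Q) \<subseteq> Q"
proof -
  let ?S = "killed_vertices G Q"
  have minor: "minor v w \<in> Q" if "(v, w) \<in> (remaining_edges G ?S)\<^sup>*" "v \<in> fst G" for v w
    using that(1)
  proof (induction rule: rtrancl_induct)
    case base
    then show ?case using prime_0[OF Q(1)] by (simp add: minor_def)
  next
    case (step u w)
    have u: "u \<in> fst G" "w \<in> fst G" "\<not> (x_var u \<in> Q \<and> y_var u \<in> Q)" and e: "{u, w} \<in> snd G"
      using step(2) by (auto simp: remaining_edges_def killed_vertices_def)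
    have uw: "minor u w \<in> Q" using Q(2) e binomial_edge_ideal_subset_iff[OF G Q(1)] by blast
    have "x_var u * minor v w = x_var v * minor u w + x_var w * minor v u"
      "y_var u * minor v w = y_var v * minor u w + y_var w * minor v u"
      by (simp_all add: minor_def algebra_simps)
    moreover have "x_var v * minor u w + x_var w * minor v u \<in> Q" "y_var v * minor u w + y_var w * minor v u \<in> Q"
      by (intro prime_add[OF Q(1)] prime_mult[OF Q(1)] carrier_var that(2) u uw step.IH)+
    ultimately have "x_var u * minor v w \<in> Q" "y_var u * minor v w \<in> Q" by metis+
    then show ?case
      using prime_prime[OF Q(1)] u that(2) by (meson carrier_var carrier_minor)
  qed
  show ?thesis
    unfolding component_prime_def
  proof (rule parallel_prime_subset_prime[OF _ _ Q(1)])
    show "finite (fst G)" using G by (simp add: finite_simple_graph_def)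
    show "minor v w \<in> Q" if "v \<in> fst G - ?S" "component G ?S v = component G ?S w" for v w
      using minor that component_eq_iff by (metis DiffD1)
  qed (auto simp: killed_vertices_def)
qed

text \<open>
  If all neighbours of some \<open>s \<in> S\<close> outside \<open>S\<close> lie in one component, then putting \<open>s\<close> back connects no
  two components, and \<open>S - {s}\<close> gives a strictly smaller prime.
\<close>

lemma cut_set_of_minimal_component_prime:
  assumes G: "finite_simple_graph G" and "S \<subseteq> fst G"
    and min: "(component_prime G S :: ('v::countable, 'k::field) edge_poly set)
      \<in> minimal_primes (graph_ring G) (binomial_edge_ideal G)"
  shows "cut_set G S"
proof (rule ccontr)
  assume "\<not> cut_set G S"
  then obtain s where s: "s \<in> S" "\<And>v w. v \<in> fst G - S \<Longrightarrow> w \<in> fst G - S \<Longrightarrow> {s, v} \<in> snd G \<Longrightarrow>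
      {s, w} \<in> snd G \<Longrightarrow> (v, w) \<in> (remaining_edges G S)\<^sup>*"
    using assms(2) unfolding cut_set_def component_eq_iff by blast
  let ?S = "S - {s}"
  \<comment> \<open>A path through \<open>s\<close> enters and leaves \<open>s\<close> by neighbours that are connected already.\<close>
  have reach: "(w \<noteq> s \<longrightarrow> (v, w) \<in> (remaining_edges G S)\<^sup>*) \<and>
      (w = s \<longrightarrow> (\<exists>u\<in>fst G - S. {s, u} \<in> snd G \<and> (v, u) \<in> (remaining_edges G S)\<^sup>*))"
    if "(v, w) \<in> (remaining_edges G ?S)\<^sup>*" "v \<in> fst G - S" for v w
    using that(1)
  proof (induction rule: rtrancl_induct)
    case base
    then show ?case using that(2) s(1) by auto
  next
    case (step u w)
    have uw: "u \<in> fst G - ?S" "w \<in> fst G - ?S" "{u, w} \<in> snd G"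
      using step(2) by (auto simp: remaining_edges_def)
    have "u \<noteq> w" using edge_in_vertices[OF G uw(3)] by simp
    consider "u \<noteq> s" "w \<noteq> s" | "u \<noteq> s" "w = s" | "u = s" "w \<noteq> s" using \<open>u \<noteq> w\<close> by blast
    then show ?case
    proof cases
      case 1
      then have "(u, w) \<in> remaining_edges G S" using uw by (auto simp: remaining_edges_def)
      then show ?thesis using step.IH 1 by (auto intro: rtrancl_into_rtrancl)
    next
      case 2
      then show ?thesis using step.IH uw by (auto simp: insert_commute)
    next
      case 3
      then obtain u' where u': "u' \<in> fst G - S" "{s, u'} \<in> snd G" "(v, u') \<in> (remaining_edges G S)\<^sup>*"
        using step.IH by blast
      then show ?thesis using s(2)[of u' w] uw 3 by (auto intro: rtrancl_trans)
    qed
  qed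
  have "component_prime G ?S \<subseteq> (component_prime G S :: ('v, 'k) edge_poly set)"
    unfolding component_prime_def
  proof (rule parallel_prime_mono)
    show "component G S v = component G S w"
      if "v \<in> fst G - S" "w \<in> fst G - S" "component G ?S v = component G ?S w" for v w
      using reach[of v w] that s(1) unfolding component_eq_iff by auto
  qed auto
  then have "component_prime G ?S = (component_prime G S :: ('v, 'k) edge_poly set)"
    using min component_prime_primeideal binomial_edge_ideal_subset_component_prime[OF G]
    unfolding minimal_primes_def by blast
  moreover have "s \<in> fst G" using s(1) assms(2) by blast
  ultimately show False
    using s(1) x_var_in_parallel_prime_iff[of s "fst G", where ?'k = 'k] unfolding component_prime_def by blast
qed

text \<open>
  For a cut set \<open>S\<close> and a prime \<open>Q\<close> between the ideal and \<open>P_S\<close>, both variables of every \<open>s \<in> S\<close>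
  lie in \<open>Q\<close>: otherwise \<open>s\<close> would connect two components of \<open>G - S\<close>, and the minor of a vertex from
  each would lie in \<open>Q\<close> but not in \<open>P_S\<close>.
\<close>

theorem minimal_primes_binomial_edge_ideal:
  assumes G: "finite_simple_graph G"
  shows "minimal_primes (graph_ring G) (binomial_edge_ideal G)
    = (component_prime G ` {S. cut_set G S} :: ('v::countable, 'k::field) edge_poly set set)"
proof (intro equalityI subsetI)
  fix P :: "('v, 'k) edge_poly set"
  assume P: "P \<in> minimal_primes (graph_ring G) (binomial_edge_ideal G)"
  let ?S = "killed_vertices G P"
  have "component_prime G ?S \<subseteq> P"
    using component_prime_killed_vertices_subset[OF G] P by (auto simp: minimal_primes_def)
  then have "component_prime G ?S = P"
    using P component_prime_primeideal binomial_edge_ideal_subset_component_prime[OF G]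
    unfolding minimal_primes_def by blast
  moreover have "cut_set G ?S"
    by (rule cut_set_of_minimal_component_prime[OF G, where ?'k = 'k])
       (use P calculation in \<open>auto simp: killed_vertices_def\<close>)
  ultimately show "P \<in> component_prime G ` {S. cut_set G S}" by blast
next
  fix P :: "('v, 'k) edge_poly set"
  assume "P \<in> component_prime G ` {S. cut_set G S}"
  then obtain S where S: "cut_set G S" and P: "P = component_prime G S" by blast
  have "Q = P" if Q: "primeideal Q (graph_ring G)" "binomial_edge_ideal G \<subseteq> Q" "Q \<subseteq> P" for Q
  proof -
    let ?S = "killed_vertices G Q"
    have sub: "component_prime G ?S \<subseteq> Q" by (rule component_prime_killed_vertices_subset[OF G Q(1,2)])
    have "?S \<subseteq> S"
      using Q(3) x_var_in_parallel_prime_iff[of _ "fst G" S "component G S", where ?'k = 'k]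
      by (auto simp: killed_vertices_def P component_prime_def)
    moreover have "s \<in> ?S" if s: "s \<in> S" for s
    proof (rule ccontr)
      assume ns: "s \<notin> ?S"
      obtain v w where vw: "v \<in> fst G - S" "w \<in> fst G - S" "{s, v} \<in> snd G" "{s, w} \<in> snd G"
        "component G S v \<noteq> component G S w"
        using S s unfolding cut_set_def by blast
      have "s \<in> fst G - ?S" "v \<in> fst G - ?S" "w \<in> fst G - ?S"
        using S s ns vw \<open>?S \<subseteq> S\<close> by (auto simp: cut_set_def)
      then have "component G ?S v = component G ?S w"
        using component_edge[of s G ?S] vw by metis
      then have "minor v w \<in> (component_prime G ?S :: ('v, 'k) edge_poly set)"
        using vw by (simp add: component_prime_def minor_in_parallel_prime_iff)
      then have "minor v w \<in> P" using sub Q(3) by blast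
      then show False
        using vw by (simp add: P component_prime_def minor_in_parallel_prime_iff)
    qed
    ultimately have "?S = S" by blast
    then show "Q = P" using sub Q(3) P by simp
  qed
  then show "P \<in> minimal_primes (graph_ring G) (binomial_edge_ideal G)"
    unfolding minimal_primes_def P
    by (intro CollectI conjI allI impI component_prime_primeideal
        binomial_edge_ideal_subset_component_prime[OF G])
qed

lemma prime_height_component_prime:
  assumes G: "finite_simple_graph G" and "fst G \<noteq> {}" "cut_set G S"
  shows "prime_height (graph_ring G) (component_prime G S :: ('v::countable, 'k::field) edge_poly set)
    = enat (card (fst G) + card S - num_components G S)"
proof -
  have "S \<subset> fst G" using assms(2,3) by (auto simp: cut_set_def)
  then show ?thesis
    using G by (simp add: component_prime_def num_components_def prime_height_parallel_prime
        finite_simple_graph_def)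
qed


section \<open>Counting components of graphs with a Hamiltonian path\<close>

text \<open>
  Going along the path, a component can be met for the first time only at the start or directly after
  a vertex of \<open>S\<close>.
\<close>

lemma num_components_le_hamiltonian_path:
  assumes "finite (fst G)" "S \<subseteq> fst G" "fst G = p ` {..<N}" "inj_on p {..<N}"
    and edge: "\<And>i. Suc i < N \<Longrightarrow> {p i, p (Suc i)} \<in> snd G"
  shows "num_components G S \<le> Suc (card S)"
proof -
  let ?I = "{i. i < N \<and> p i \<in> S}"
  let ?C = "insert (component G S (p 0)) ((\<lambda>i. component G S (p (Suc i))) ` ?I)"
  have "component G S (p i) \<in> ?C" if "i < N" "p i \<notin> S" for i
    using that
  proof (induction i)
    case (Suc i)
    then have v: "p i \<in> fst G" "p (Suc i) \<in> fst G" using assms(3) by auto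
    show ?case
    proof (cases "p i \<in> S")
      case False
      then have "component G S (p i) = component G S (p (Suc i))"
        using v Suc.prems edge by (intro component_edge) auto
      then show ?thesis using Suc False by auto
    qed (use Suc.prems in auto)
  qed simp
  then have "component G S ` (fst G - S) \<subseteq> ?C" using assms(3) by auto
  then have "num_components G S \<le> card ?C"
    unfolding num_components_def by (intro card_mono) auto
  also have "\<dots> \<le> Suc (card ((\<lambda>i. component G S (p (Suc i))) ` ?I))" by (rule card_insert_le_m1) auto
  also have "\<dots> \<le> Suc (card ?I)" by (simp add: card_image_le)
  also have "card ?I \<le> card S"
  proof (rule card_inj_on_le[of p])
    show "inj_on p ?I" by (rule inj_on_subset[OF assms(4)]) auto
    show "finite S" using assms(1,2) finite_subset by blast
  qed auto
  finally show ?thesis by simp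
qed

lemma isolated_component:
  assumes "component G S v = component G S w" and isolated: "\<And>u. u \<in> fst G - S \<Longrightarrow> {v, u} \<notin> snd G"
  shows "v = w"
  using assms(1) unfolding component_eq_iff
  by (rule converse_rtranclE) (use isolated in \<open>auto simp: remaining_edges_def\<close>)


section \<open>Cut sets of nearly complete bipartite graphs\<close>

text \<open>
  One half of a symmetric situation: every vertex of \<open>Y\<close> misses exactly two vertices of \<open>X\<close>, and
  two vertices of \<open>Y\<close> miss at most one common vertex.  The bipartite complement of a cycle satisfies
  this for both orders of its sides.
\<close>

locale near_biclique =
  fixes G :: "'v set \<times> 'v set set" and X Y S :: "'v set"
  assumes graph: "finite_simple_graph G" and vertices: "fst G = X \<union> Y" "X \<inter> Y = {}"
    and cross: "{v, w} \<in> snd G \<Longrightarrow> v \<in> X \<longleftrightarrow> w \<in> Y"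
    and non_nbrs: "y \<in> Y \<Longrightarrow> card {x \<in> X. {x, y} \<notin> snd G} = 2"
    and common_non_nbrs: "y \<in> Y \<Longrightarrow> y' \<in> Y \<Longrightarrow> y \<noteq> y' \<Longrightarrow>
      card ({x \<in> X. {x, y} \<notin> snd G} \<inter> {x \<in> X. {x, y'} \<notin> snd G}) \<le> 1"
    and cut: "cut_set G S"
begin

lemma finite_sides: "finite X" "finite Y"
  using graph vertices by (auto simp: finite_simple_graph_def)

lemma separated_neighbours:
  assumes "s \<in> X" "s \<in> S"
  obtains y y' where "y \<in> Y - S" "y' \<in> Y - S" "{s, y} \<in> snd G" "{s, y'} \<in> snd G"
    "component G S y \<noteq> component G S y'"
proof -
  obtain v w where vw: "v \<in> fst G - S" "w \<in> fst G - S" "{s, v} \<in> snd G" "{s, w} \<in> snd G"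
    "component G S v \<noteq> component G S w"
    using cut assms unfolding cut_set_def by blast
  then have "v \<in> Y - S" "w \<in> Y - S" using cross assms by auto
  then show ?thesis using vw that by blast
qed

lemma two_le_card_other_side:
  assumes "X \<inter> S \<noteq> {}"
  shows "2 \<le> card (Y - S)"
proof -
  obtain y y' where "y \<in> Y - S" "y' \<in> Y - S" "component G S y \<noteq> component G S y'"
    using assms separated_neighbours by blast
  then have "card {y, y'} \<le> card (Y - S)" "y \<noteq> y'"
    using finite_sides by (auto intro!: card_mono)
  then show ?thesis by simp
qed

lemma two_le_num_components:
  assumes "X \<inter> S \<noteq> {}"
  shows "2 \<le> num_components G S"
proof -
  obtain y y' where y: "y \<in> Y - S" "y' \<in> Y - S" "component G S y \<noteq> component G S y'"
    using assms separated_neighbours by blast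
  then have "card {component G S y, component G S y'} \<le> num_components G S"
    unfolding num_components_def using finite_sides vertices by (intro card_mono) auto
  then show ?thesis using y by simp
qed

text \<open>
  Let \<open>y\<close>, \<open>y'\<close> be the remaining vertices of \<open>Y\<close>.  Every deleted vertex of \<open>X\<close> is adjacent to both, so the at
  least three vertices of \<open>X\<close> missed by \<open>y\<close> or \<open>y'\<close> remain.  If there are just three of them, \<open>y\<close> and
  \<open>y'\<close> miss a common vertex \<open>w\<close>, which is isolated, and \<open>w\<close>, \<open>y\<close>, \<open>y'\<close> lie in three components.
\<close>

lemma eight_le_if_two_on_other_side:
  assumes "X \<inter> S \<noteq> {}" "card (Y - S) = 2"
  shows "8 \<le> card (X - S) + card (Y - S) + num_components G S"
proof -
  let ?N = "\<lambda>y. {x \<in> X. {x, y} \<notin> snd G}"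
  obtain y y' where y: "Y - S = {y, y'}" "y \<noteq> y'"
    using assms(2) by (auto simp: card_2_iff)
  have adj: "{s, y} \<in> snd G" "{s, y'} \<in> snd G" "component G S y \<noteq> component G S y'" if "s \<in> X \<inter> S" for s
  proof -
    from that have "s \<in> X" "s \<in> S" by auto
    then obtain z z' where z: "z \<in> Y - S" "z' \<in> Y - S" "{s, z} \<in> snd G" "{s, z'} \<in> snd G"
      "component G S z \<noteq> component G S z'"
      by (rule separated_neighbours)
    then have "z = y \<and> z' = y' \<or> z = y' \<and> z' = y" unfolding y(1) by auto
    then show "{s, y} \<in> snd G" "{s, y'} \<in> snd G" "component G S y \<noteq> component G S y'"
      using z by auto
  qed
  then have sub: "?N y \<union> ?N y' \<subseteq> X - S" by blast
  have yY: "y \<in> Y" "y' \<in> Y" using y by auto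
  have fin: "finite (?N y)" "finite (?N y')" using finite_sides by auto
  have "card (?N y \<union> ?N y') + card (?N y \<inter> ?N y') = 4"
    using card_Un_Int[OF fin] non_nbrs yY by simp
  moreover have "card (?N y \<inter> ?N y') \<le> 1" using common_non_nbrs yY y(2) by blast
  moreover have "card (?N y \<union> ?N y') \<le> card (X - S)" using sub finite_sides by (intro card_mono) auto
  ultimately have card: "3 \<le> card (X - S)" "card (X - S) = 3 \<Longrightarrow> card (?N y \<inter> ?N y') \<noteq> 0" by auto
  show ?thesis
  proof (cases "card (X - S) = 3")
    case True
    have "?N y \<inter> ?N y' \<noteq> {}"
    proof
      assume "?N y \<inter> ?N y' = {}"
      then show False using card(2)[OF True] by simp
    qed
    then obtain w where w: "w \<in> ?N y" "w \<in> ?N y'" by blast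
    then have wX: "w \<in> X - S" using sub by blast
    have "{w, u} \<notin> snd G" if "u \<in> fst G - S" for u
    proof
      assume e: "{w, u} \<in> snd G"
      then have "u \<in> Y - S" using cross wX that by blast
      then show False using w e unfolding y(1) by auto
    qed
    note isolated = isolated_component[OF _ this]
    have "w \<noteq> y" "w \<noteq> y'" using wX yY vertices(2) by auto
    then have "component G S w \<noteq> component G S y" "component G S w \<noteq> component G S y'"
      using isolated by blast+
    moreover have "component G S y \<noteq> component G S y'" using adj assms(1) by blast
    moreover have "card {component G S w, component G S y, component G S y'} \<le> num_components G S"
      unfolding num_components_def using finite_sides vertices wX y(1) by (intro card_mono) auto
    ultimately show ?thesis using True assms(2) by simp
  next
    case False
    then show ?thesis using card(1) two_le_num_components[OF assms(1)] assms(2) by simp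
  qed
qed

text \<open>
  Either no vertex of \<open>Y\<close> remains and the at least five vertices of \<open>X\<close> are isolated, or the count is at
  least \<open>5 + 1 + 2\<close>.
\<close>

lemma eight_le_if_side_contained:
  assumes "X \<inter> S = {}" "5 \<le> card X" "2 \<le> num_components G S"
  shows "8 \<le> card (X - S) + card (Y - S) + num_components G S"
proof (cases "Y - S = {}")
  case True
  then have "fst G - S = X" using assms(1) vertices by auto
  moreover have "inj_on (component G S) X"
  proof (rule inj_onI)
    fix x x' assume x: "x \<in> X" "x' \<in> X" "component G S x = component G S x'"
    show "x = x'"
      by (rule isolated_component[OF x(3)]) (use True cross[of x] x(1) vertices in auto)
  qed
  ultimately have "num_components G S = card X" by (simp add: num_components_def card_image)
  moreover have "X - S = X" using assms(1) by blast
  ultimately show ?thesis using assms(2) by simp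
next
  case False
  then have "card (Y - S) \<noteq> 0" using finite_sides by simp
  moreover have "X - S = X" using assms(1) by blast
  ultimately show ?thesis using assms(2,3) by simp
qed

end

text \<open>
  If vertices of both sides are deleted, at least two vertices remain on each side.  The case of exactly
  two on some side is covered above; otherwise the count is at least \<open>3 + 3 + 2\<close>.
\<close>

theorem eight_le_remaining_plus_components:
  assumes "near_biclique G X Y S" "near_biclique G Y X S" "5 \<le> card X" "5 \<le> card Y"
  shows "8 \<le> card (X - S) + card (Y - S) + num_components G S"
proof -
  interpret near_biclique G X Y S by fact
  interpret swap: near_biclique G Y X S by fact
  consider "X \<inter> S = {}" "Y \<inter> S = {}" | "X \<inter> S = {}" "Y \<inter> S \<noteq> {}" | "X \<inter> S \<noteq> {}" "Y \<inter> S = {}"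
    | "X \<inter> S \<noteq> {}" "Y \<inter> S \<noteq> {}" by blast
  then show ?thesis
  proof cases
    case 1
    then have "X - S = X" "Y - S = Y" by auto
    then show ?thesis using assms(3,4) by simp
  next
    case 2
    then show ?thesis using eight_le_if_side_contained assms(3) swap.two_le_num_components by blast
  next
    case 3
    then show ?thesis
      using swap.eight_le_if_side_contained assms(4) two_le_num_components by (simp add: add.commute)
  next
    case 4
    then show ?thesis
      using two_le_card_other_side swap.two_le_card_other_side two_le_num_components
        eight_le_if_two_on_other_side swap.eight_le_if_two_on_other_side
      by (cases "card (X - S) = 2 \<or> card (Y - S) = 2") auto
  qed
qed


section \<open>The bipartite complement of a cycle\<close>

instance vertex :: countable by countable_datatype

context
  fixes n :: nat
  assumes n: "5 \<le> n"
begin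

abbreviation (input) "Gn \<equiv> bip_compl_cycle n"

lemma vertices_bip_compl_cycle: "fst Gn = U ` {..<n} \<union> V ` {..<n}"
  by (simp add: bip_compl_cycle_def)

lemma card_U: "card (U ` {..<n}) = n" and card_V: "card (V ` {..<n}) = n"
  by (simp_all add: card_image inj_on_def)

lemma card_vertices: "card (fst Gn) = 2 * n"
  unfolding vertices_bip_compl_cycle
  by (subst card_Un_disjoint) (auto simp: card_U card_V)

lemma finite_vertices: "finite (fst Gn)"
  by (simp add: vertices_bip_compl_cycle)

text \<open>
  The successor modulo \<open>n\<close>, by cases so that linear arithmetic applies.
\<close>

definition next_idx :: "nat \<Rightarrow> nat" where
  "next_idx j = (if Suc j = n then 0 else Suc j)"

lemma edge_iff: "{U i, V j} \<in> snd Gn \<longleftrightarrow> i < n \<and> j < n \<and> i \<noteq> j \<and> i \<noteq> next_idx j"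
proof -
  have "[int j = int i] (mod int n) \<longleftrightarrow> i = j" if "i < n" "j < n"
    using that by (auto simp: cong_int_iff cong_def)
  moreover have "[int j = int i - 1] (mod int n) \<longleftrightarrow> i = next_idx j" if "i < n" "j < n"
  proof -
    have "[int j = int i - 1] (mod int n) \<longleftrightarrow> [int j + 1 = int i] (mod int n)"
      by (simp add: cong_iff_dvd_diff algebra_simps)
    also have "\<dots> \<longleftrightarrow> [Suc j = i] (mod n)"
      by (metis cong_int_iff of_nat_Suc add.commute)
    also have "\<dots> \<longleftrightarrow> i = next_idx j" using that by (auto simp: cong_def next_idx_def)
    finally show ?thesis .
  qed
  ultimately show ?thesis
    by (auto simp: bip_compl_cycle_def doubleton_eq_iff)
qed

lemma edge_iff': "{V j, U i} \<in> snd Gn \<longleftrightarrow> i < n \<and> j < n \<and> i \<noteq> j \<and> i \<noteq> next_idx j"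
  using edge_iff by (simp add: insert_commute)

lemma edge_cases:
  assumes "{v, w} \<in> snd Gn"
  obtains i j where "v = U i" "w = V j" "{U i, V j} \<in> snd Gn" | i j where "v = V j" "w = U i" "{U i, V j} \<in> snd Gn"
  using assms by (auto simp: bip_compl_cycle_def doubleton_eq_iff)

lemma near_biclique_U_V:
  assumes "cut_set Gn S"
  shows "near_biclique Gn (U ` {..<n}) (V ` {..<n}) S"
proof
  have N: "{x \<in> U ` {..<n}. {x, V j} \<notin> snd Gn} = {U j, U (next_idx j)}" if "j < n" for j
  proof -
    have "{x \<in> U ` {..<n}. {x, V j} \<notin> snd Gn} = U ` {i. i < n \<and> (i = j \<or> i = next_idx j)}"
      using that by (auto simp: edge_iff)
    also have "\<dots> = {U j, U (next_idx j)}" using that n by (auto simp: next_idx_def)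
    finally show ?thesis .
  qed
  show "card {x \<in> U ` {..<n}. {x, y} \<notin> snd Gn} = 2" if "y \<in> V ` {..<n}" for y
    using that n by (auto simp: N next_idx_def)
  show "card ({x \<in> U ` {..<n}. {x, y} \<notin> snd Gn} \<inter> {x \<in> U ` {..<n}. {x, y'} \<notin> snd Gn}) \<le> 1"
    if ys: "y \<in> V ` {..<n}" "y' \<in> V ` {..<n}" "y \<noteq> y'" for y y'
  proof -
    obtain j j' where j: "y = V j" "y' = V j'" "j < n" "j' < n" "j \<noteq> j'" using ys by auto
    then have "card ({U j, U (next_idx j)} \<inter> {U j', U (next_idx j')}) \<le> Suc 0"
      using n by (subst card_le_Suc0_iff_eq) (auto simp: next_idx_def split: if_splits)
    then show ?thesis using j by (simp add: N)
  qed
  show "v \<in> U ` {..<n} \<longleftrightarrow> w \<in> V ` {..<n}" if "{v, w} \<in> snd Gn" for v w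
    using that by (rule edge_cases) (auto simp: edge_iff)
qed (use assms in \<open>auto simp: vertices_bip_compl_cycle finite_simple_graph_bip_compl_cycle\<close>)

lemma near_biclique_V_U:
  assumes "cut_set Gn S"
  shows "near_biclique Gn (V ` {..<n}) (U ` {..<n}) S"
proof
  have N: "{x \<in> V ` {..<n}. {x, U i} \<notin> snd Gn} = {V i, V (if i = 0 then n - 1 else i - 1)}" if "i < n" for i
  proof -
    have "{x \<in> V ` {..<n}. {x, U i} \<notin> snd Gn} = V ` {j. j < n \<and> (i = j \<or> i = next_idx j)}"
      using that by (auto simp: edge_iff')
    also have "\<dots> = {V i, V (if i = 0 then n - 1 else i - 1)}"
      using that n by (auto simp: next_idx_def image_iff split: if_splits)
    finally show ?thesis .
  qed
  show "card {x \<in> V ` {..<n}. {x, y} \<notin> snd Gn} = 2" if "y \<in> U ` {..<n}" for y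
    using that n by (auto simp: N)
  show "card ({x \<in> V ` {..<n}. {x, y} \<notin> snd Gn} \<inter> {x \<in> V ` {..<n}. {x, y'} \<notin> snd Gn}) \<le> 1"
    if ys: "y \<in> U ` {..<n}" "y' \<in> U ` {..<n}" "y \<noteq> y'" for y y'
  proof -
    define q where "q = (\<lambda>i. if i = 0 then n - 1 else i - 1)"
    obtain i i' where i: "y = U i" "y' = U i'" "i < n" "i' < n" "i \<noteq> i'" using ys by auto
    then have "card ({V i, V (q i)} \<inter> {V i', V (q i')}) \<le> Suc 0"
      using n by (subst card_le_Suc0_iff_eq) (auto simp: q_def split: if_splits)
    then show ?thesis using i by (simp add: N q_def)
  qed
  show "v \<in> V ` {..<n} \<longleftrightarrow> w \<in> U ` {..<n}" if "{v, w} \<in> snd Gn" for v w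
    using that by (rule edge_cases) (auto simp: edge_iff)
qed (use assms in \<open>auto simp: vertices_bip_compl_cycle finite_simple_graph_bip_compl_cycle\<close>)

lemma eight_le_cut_set:
  assumes "cut_set Gn S"
  shows "card S + 8 \<le> 2 * n + num_components Gn S"
proof -
  have S: "S \<subseteq> fst Gn" using assms by (simp add: cut_set_def)
  then have fin: "finite S" using finite_subset finite_vertices by blast
  have "8 \<le> card (U ` {..<n} - S) + card (V ` {..<n} - S) + num_components Gn S"
    by (rule eight_le_remaining_plus_components)
       (use assms n in \<open>simp_all add: near_biclique_U_V near_biclique_V_U card_U card_V\<close>)
  moreover have "card (U ` {..<n} - S) + card (V ` {..<n} - S) = card (fst Gn - S)"
    unfolding vertices_bip_compl_cycle Un_Diff by (rule card_Un_disjoint [symmetric]) auto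
  moreover have "card (fst Gn - S) = 2 * n - card S" "card S \<le> 2 * n"
    using S fin card_mono[OF finite_vertices S] by (simp_all add: card_Diff_subset card_vertices)
  ultimately show ?thesis by simp
qed

text \<open>
  The Hamiltonian path is \<open>u_0, v_2, u_1, v_3, u_2, v_4, \<dots>\<close>; its edges \<open>u_i v_j\<close> have
  \<open>j - i = 2\<close> or \<open>j - i = 1\<close> modulo \<open>n\<close>, whereas the missing edges of \<open>G\<close> are those with \<open>j - i = 0\<close> or
  \<open>j - i = -1\<close>.
\<close>

lemma num_components_le:
  assumes "S \<subseteq> fst Gn"
  shows "num_components Gn S \<le> Suc (card S)"
proof -
  define p where "p = (\<lambda>i. if even i then U (i div 2) else V ((i div 2 + 2) mod n))"
  have "U i \<in> p ` {..<2 * n}" if "i < n" for i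
    by (rule image_eqI[of _ _ "2 * i"]) (use that in \<open>auto simp: p_def\<close>)
  moreover have "V j \<in> p ` {..<2 * n}" if "j < n" for j
  proof (rule image_eqI[of _ _ "2 * ((j + n - 2) mod n) + 1"])
    have "((j + n - 2) mod n + 2) mod n = (j + n - 2 + 2) mod n" by (rule mod_add_left_eq)
    also have "j + n - 2 + 2 = j + n" using n by simp
    also have "(j + n) mod n = j" using that by simp
    finally show "V j = p (2 * ((j + n - 2) mod n) + 1)" using that n by (simp add: p_def)
    have "(j + n - 2) mod n < n" using n by simp
    then show "2 * ((j + n - 2) mod n) + 1 \<in> {..<2 * n}" by auto
  qed
  moreover have "p ` {..<2 * n} \<subseteq> fst Gn" using n by (auto simp: p_def vertices_bip_compl_cycle)
  ultimately have img: "fst Gn = p ` {..<2 * n}" unfolding vertices_bip_compl_cycle by blast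
  have even: "p (2 * k) = U k" and odd: "p (Suc (2 * k)) = V (next_idx (next_idx k))" if "k < n" for k
    using that n by (auto simp: p_def next_idx_def mod_if)
  show ?thesis
  proof (rule num_components_le_hamiltonian_path[OF _ assms img])
    show "inj_on p {..<2 * n}"
      by (rule eq_card_imp_inj_on) (use card_vertices img in auto)
    show "{p i, p (Suc i)} \<in> snd Gn" if "Suc i < 2 * n" for i
    proof -
      consider k where "i = 2 * k" | k where "i = Suc (2 * k)"
        by (metis evenE oddE Suc_eq_plus1)
      then show ?thesis
      proof cases
        case 1
        then have k: "k < n" "next_idx (next_idx k) < n" "k \<noteq> next_idx (next_idx k)" "k \<noteq> next_idx (next_idx (next_idx k))"
          using that n by (auto simp: next_idx_def)
        show ?thesis unfolding 1 even[OF k(1)] odd[OF k(1)] edge_iff using k by blast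
      next
        case 2
        then have k: "k < n" "Suc k < n" "next_idx (next_idx k) < n" "Suc k \<noteq> next_idx (next_idx k)"
            "Suc k \<noteq> next_idx (next_idx (next_idx k))" "Suc (Suc (2 * k)) = 2 * Suc k"
          using that n by (auto simp: next_idx_def)
        show ?thesis unfolding 2 k(6) even[OF k(2)] odd[OF k(1)] edge_iff' using k by blast
      qed
    qed
  qed (simp add: vertices_bip_compl_cycle)
qed

text \<open>
  The five remaining vertices form a path \<open>v_0 u_1 v_1 u_2 v_2\<close> of the cycle.
\<close>

definition big_cut :: "vertex set" where
  "big_cut = fst Gn - {U 1, U 2, V 0, V 1, V 2}"

lemma remaining_big_cut: "fst Gn - big_cut = {U 1, U 2, V 0, V 1, V 2}"
  using n by (auto simp: big_cut_def vertices_bip_compl_cycle)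

lemma card_big_cut: "card big_cut = 2 * n - 5"
proof -
  have "card big_cut = card (fst Gn) - card {U 1, U 2, V 0, V 1, V 2}"
    unfolding big_cut_def
    by (rule card_Diff_subset) (use n in \<open>auto simp: vertices_bip_compl_cycle\<close>)
  then show ?thesis by (simp add: card_vertices)
qed

lemma remaining_edges_big_cut:
  "remaining_edges Gn big_cut = {(U 1, V 2), (V 2, U 1), (U 2, V 0), (V 0, U 2)}"
proof -
  have "(v, w) \<in> remaining_edges Gn big_cut \<longleftrightarrow> (v, w) \<in> {(U 1, V 2), (V 2, U 1), (U 2, V 0), (V 0, U 2)}" for v w
  proof
    assume "(v, w) \<in> remaining_edges Gn big_cut"
    then have vw: "v \<in> {U 1, U 2, V 0, V 1, V 2}" "w \<in> {U 1, U 2, V 0, V 1, V 2}" "{v, w} \<in> snd Gn"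
      unfolding remaining_edges_def remaining_big_cut by auto
    from vw(3) show "(v, w) \<in> {(U 1, V 2), (V 2, U 1), (U 2, V 0), (V 0, U 2)}"
      by (rule edge_cases) (use vw(1,2) in \<open>auto simp: edge_iff next_idx_def\<close>)
  next
    assume "(v, w) \<in> {(U 1, V 2), (V 2, U 1), (U 2, V 0), (V 0, U 2)}"
    moreover have "{U 1, V 2} \<in> snd Gn" "{U 2, V 0} \<in> snd Gn" "{V 2, U 1} \<in> snd Gn" "{V 0, U 2} \<in> snd Gn"
      unfolding edge_iff edge_iff' using n by (auto simp: next_idx_def)
    ultimately show "(v, w) \<in> remaining_edges Gn big_cut"
      unfolding remaining_edges_def remaining_big_cut by auto
  qed
  then show ?thesis unfolding set_eq_iff split_paired_All by blast
qed

lemma cut_set_big_cut: "cut_set Gn big_cut"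
proof -
  have closed: "w \<in> {U 1, V 2}" if "(U 1, w) \<in> (remaining_edges Gn big_cut)\<^sup>*" for w
    using that by (induction rule: rtrancl_induct) (auto simp: remaining_edges_big_cut)
  have closed': "w = V 1" if "(V 1, w) \<in> (remaining_edges Gn big_cut)\<^sup>*" for w
    using that by (induction rule: rtrancl_induct) (auto simp: remaining_edges_big_cut)
  have sep: "component Gn big_cut (U 1) \<noteq> component Gn big_cut (U 2)"
    "component Gn big_cut (V 1) \<noteq> component Gn big_cut (V 0)"
    "component Gn big_cut (V 1) \<noteq> component Gn big_cut (V 2)"
    using closed[of "U 2"] closed'[of "V 0"] closed'[of "V 2"] by (auto simp: component_eq_iff)
  have "\<exists>v\<in>{U 1, U 2, V 0, V 1, V 2}. \<exists>w\<in>{U 1, U 2, V 0, V 1, V 2}.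
      {s, v} \<in> snd Gn \<and> {s, w} \<in> snd Gn \<and> component Gn big_cut v \<noteq> component Gn big_cut w"
    if s: "s \<in> big_cut" for s
  proof (cases s)
    case (U i)
    then have i: "i < n" "i \<noteq> 1" "i \<noteq> 2" using s by (auto simp: big_cut_def vertices_bip_compl_cycle)
    then have "{s, V 1} \<in> snd Gn" "{s, V 0} \<in> snd Gn \<or> {s, V 2} \<in> snd Gn"
      using n unfolding U edge_iff by (auto simp: next_idx_def)
    then consider "{s, V 1} \<in> snd Gn" "{s, V 0} \<in> snd Gn" | "{s, V 1} \<in> snd Gn" "{s, V 2} \<in> snd Gn"
      by blast
    then show ?thesis
      by cases (use sep in \<open>intro bexI[of _ "V 1"] bexI[of _ "V 0"] conjI; simp\<close>,
        use sep in \<open>intro bexI[of _ "V 1"] bexI[of _ "V 2"] conjI; simp\<close>)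
  next
    case (V j)
    then have j: "j < n" "j \<noteq> 0" "j \<noteq> 1" "j \<noteq> 2"
      using s by (auto simp: big_cut_def vertices_bip_compl_cycle)
    then have "{s, U 1} \<in> snd Gn" "{s, U 2} \<in> snd Gn"
      using n unfolding V edge_iff' by (auto simp: next_idx_def)
    then show ?thesis
      using sep by (intro bexI[of _ "U 1"] bexI[of _ "U 2"] conjI; simp)
  qed
  then show ?thesis
    unfolding cut_set_def remaining_big_cut by (auto simp: big_cut_def)
qed

text \<open>
  At most three components are visible; at least three are forced by the general bound for cut sets.
\<close>

lemma num_components_big_cut: "num_components Gn big_cut = 3"
proof -
  let ?c = "component Gn big_cut"
  have "?c (U 1) = ?c (V 2)" "?c (U 2) = ?c (V 0)"
    unfolding component_eq_iff by (auto simp: remaining_edges_big_cut)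
  then have "?c ` (fst Gn - big_cut) = {?c (U 1), ?c (U 2), ?c (V 1)}"
    unfolding remaining_big_cut by auto
  then have "num_components Gn big_cut \<le> 3"
    unfolding num_components_def by (simp add: card_insert_if)
  moreover have "card big_cut + 8 \<le> 2 * n + num_components Gn big_cut"
    by (rule eight_le_cut_set[OF cut_set_big_cut])
  ultimately show ?thesis using card_big_cut n by simp
qed

end

theorem corollary4p8:
  fixes n :: nat
  assumes "n \<ge> 5"
  shows "ht (graph_ring (bip_compl_cycle n) :: (vertex, 'k::field) edge_poly ring)
            (binomial_edge_ideal (bip_compl_cycle n)) = enat (2 * n - 1) \<and>
         bight (graph_ring (bip_compl_cycle n) :: (vertex, 'k) edge_poly ring)
            (binomial_edge_ideal (bip_compl_cycle n)) = enat (4 * n - 8)"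
proof -
  let ?G = "bip_compl_cycle n"
  let ?R = "graph_ring ?G :: (vertex, 'k) edge_poly ring"
  let ?P = "component_prime ?G :: vertex set \<Rightarrow> (vertex, 'k) edge_poly set"
  have G: "finite_simple_graph ?G" by (rule finite_simple_graph_bip_compl_cycle)
  have nonempty: "fst ?G \<noteq> {}" using card_vertices assms by fastforce
  have min: "minimal_primes ?R (binomial_edge_ideal ?G) = ?P ` {S. cut_set ?G S}"
    by (rule minimal_primes_binomial_edge_ideal[OF G])
  have height: "prime_height ?R (?P S) = enat (2 * n + card S - num_components ?G S)" if "cut_set ?G S" for S
    using prime_height_component_prime[OF G nonempty that] by (simp add: card_vertices[OF assms])
  have bounds: "2 * n - 1 \<le> 2 * n + card S - num_components ?G S"
    "2 * n + card S - num_components ?G S \<le> 4 * n - 8" if "cut_set ?G S" for S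
    using num_components_le[OF assms, of S] eight_le_cut_set[OF assms that] that assms
    by (auto simp: cut_set_def)
  have empty: "cut_set ?G {}" by (simp add: cut_set_def)
  have "num_components ?G {} \<noteq> 0"
    using nonempty G by (simp add: num_components_def finite_simple_graph_def)
  then have height_empty: "prime_height ?R (?P {}) = enat (2 * n - 1)"
    using height[OF empty] num_components_le[OF assms, of "{}"] by simp
  have height_big: "prime_height ?R (?P (big_cut n)) = enat (4 * n - 8)"
    using height[OF cut_set_big_cut[OF assms]] card_big_cut[OF assms] num_components_big_cut[OF assms] assms
    by simp
  have "ht ?R (binomial_edge_ideal ?G) = enat (2 * n - 1)"
    unfolding ht_def min
  proof (rule antisym)
    show "(INF P \<in> ?P ` {S. cut_set ?G S}. prime_height ?R P) \<le> enat (2 * n - 1)"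
      by (rule INF_lower2[of "?P {}"]) (use empty height_empty in auto)
    show "enat (2 * n - 1) \<le> (INF P \<in> ?P ` {S. cut_set ?G S}. prime_height ?R P)"
      by (rule INF_greatest) (use height bounds in auto)
  qed
  moreover have "bight ?R (binomial_edge_ideal ?G) = enat (4 * n - 8)"
    unfolding bight_def min
  proof (rule antisym)
    show "enat (4 * n - 8) \<le> (SUP P \<in> ?P ` {S. cut_set ?G S}. prime_height ?R P)"
      by (rule SUP_upper2[of "?P (big_cut n)"]) (use cut_set_big_cut[OF assms] height_big in auto)
    show "(SUP P \<in> ?P ` {S. cut_set ?G S}. prime_height ?R P) \<le> enat (4 * n - 8)"
      by (rule SUP_least) (use height bounds in auto)
  qed
  ultimately show ?thesis by blast
qed

end
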